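(* Let $G$ be a finite simple graph with vertex set $[n]$, $m$ edges and maximum degree $\Delta$, and let $X$ be the number of crossings of a uniformly random embedding of $G$. Let $\mu$ and $\sigma^2$ be the mean and variance of $X$, and assume $\sigma^2>0$. Then, with $W=(X-\mu)/\sigma$ and $Z$ a standard Gaussian random variable, $$d_{Kol}(W,Z)\le \frac{4m_2(G)\Delta m}{3\sigma^2}\left[\frac{6\Delta m}{\sigma}+\sqrt{1-\frac{6m_4(G)}{m_2(G)^2}+\frac{(\Delta-1)^2 m}{2m_2(G)}}\right],$$ where $m_r(G)$ is the number of $r$-matchings of $G$.
   Context: An $r$-matching of $G$ is a set of $r$ edges of $G$, no two sharing a vertex; $m_r(G)$ is their number. A uniformly random embedding is given by a uniform random permutation $\pi$ of $[n]$, placing vertex $v$ at position $\pi(v)$ among $n$ points in convex position labelled $1,\dots,n$ in cyclic order. A $2$-matching $\{\{a,b\},\{c,d\}\}$ is a crossing if exactly one of $\pi(c),\pi(d)$ lies strictly between $\min(\pi(a),\pi(b))$ and $\max(\pi(a),\pi(b))$; $X$ is the number of $2$-matchings of $G$ that are crossings. The Kolmogorov distance is $d_{Kol}(X,Y)=\sup_{z\in\mathbb{R}}|F_X(z)-F_Y(z)|$, with $F_X,F_Y$ the distribution functions. *)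

theory Defs
  imports "HOL-Probability.Probability" "HOL-Combinatorics.Permutations"
begin

definition simple_graph :: "nat \<Rightarrow> nat set set \<Rightarrow> bool" where
  "simple_graph n E \<longleftrightarrow> (\<forall>e\<in>E. e \<subseteq> {1..n} \<and> card e = 2)"

definition degree :: "nat set set \<Rightarrow> nat \<Rightarrow> nat" where
  "degree E v = card {e\<in>E. v \<in> e}"

text \<open>This is unspecified for \<open>n = 0\<close>, where the set of degrees is empty.\<close>

definition max_degree :: "nat \<Rightarrow> nat set set \<Rightarrow> nat" where
  "max_degree n E = Max (degree E ` {1..n})"

definition matchings :: "nat \<Rightarrow> nat set set \<Rightarrow> nat set set set" where
  "matchings r E = {M. M \<subseteq> E \<and> card M = r \<and> pairwise disjnt M}"

definition num_matchings :: "nat \<Rightarrow> nat set set \<Rightarrow> nat" where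
  "num_matchings r E = card (matchings r E)"

definition strictly_between :: "nat \<Rightarrow> nat \<Rightarrow> nat \<Rightarrow> bool" where
  "strictly_between i j k \<longleftrightarrow> min i j < k \<and> k < max i j"

text \<open>
  For a 2-matching \<open>M\<close> and an injective \<open>\<pi>\<close> the condition does not depend on how \<open>M\<close> is written
  as \<open>{{a, b}, {c, d}}\<close>: two chords with four distinct end points cross or not irrespective
  of the order of the chords and of their end points. The disequality of truth values says
  that exactly one of them holds.
\<close>

definition is_crossing :: "(nat \<Rightarrow> nat) \<Rightarrow> nat set set \<Rightarrow> bool" where
  "is_crossing \<pi> M \<longleftrightarrow> (\<exists>a b c d. M = {{a, b}, {c, d}} \<and>
     strictly_between (\<pi> a) (\<pi> b) (\<pi> c) \<noteq> strictly_between (\<pi> a) (\<pi> b) (\<pi> d))"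

definition crossings :: "nat set set \<Rightarrow> (nat \<Rightarrow> nat) \<Rightarrow> real" where
  "crossings E \<pi> = real (card {M \<in> matchings 2 E. is_crossing \<pi> M})"

definition random_embedding :: "nat \<Rightarrow> (nat \<Rightarrow> nat) pmf" where
  "random_embedding n = pmf_of_set {\<pi>. \<pi> permutes {1..n}}"

definition kolmogorov_dist ::
  "'a measure \<Rightarrow> ('a \<Rightarrow> real) \<Rightarrow> 'b measure \<Rightarrow> ('b \<Rightarrow> real) \<Rightarrow> real" where
  "kolmogorov_dist M X N Y =
     (SUP z. \<bar>cdf (distr M borel X) z - cdf (distr N borel Y) z\<bar>)"

end

theory Submission
  imports Defs
begin

text \<open>
  Write \<open>X\<close> as one eighth of the sum of the crossing indicators \<open>\<chi>\<close> over all quadruples \<open>(a, b, c, d)\<close>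
  such that \<open>ab\<close> and \<open>cd\<close> are disjoint edges. Exactly one of the pairings \<open>ab|cd\<close>, \<open>ac|bd\<close>, \<open>ad|bc\<close> of four
  points on a circle is a crossing, and the transposition \<open>\<tau>\<close> of \<open>b\<close> and \<open>c\<close> exchanges the first two.
  Hence \<open>Cov (X, F)\<close> is one twelfth of the sum of the expectations of \<open>\<chi> (F - F \<circ> \<tau>)\<close>. Applied to \<open>F = f W\<close>
  with the solution \<open>f\<close> of Stein's equation for an indicator, this leaves a remainder that is
  controlled by increments of monotone functions with oscillation at most 1. Since \<open>\<tau>\<close> is an
  involution preserving the uniform distribution, these increments average to covariances with a
  centred variable, and the Kolmogorov distance is at most \<open>(sd T + sd T' / 2) / \<sigma>\<^sup>2\<close> for two weighted sums
  \<open>T\<close>, \<open>T'\<close> of the gaps \<open>X - X \<circ> \<tau>\<close>.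

  Moving a single vertex \<open>w\<close> changes \<open>T\<close> and \<open>T'\<close> by at most a constant times \<open>\<Delta> m\<^sup>2 deg w\<close>, so an
  Efron--Stein bound gives variances of order \<open>\<Delta>\<^sup>3 m\<^sup>5\<close>. As \<open>\<sigma>\<^sup>2 \<le> (4/9) m\<^sub>2 \<Delta> m\<close>, this is already covered by the first
  summand \<open>8 m\<^sub>2 \<Delta>\<^sup>2 m\<^sup>2 / \<sigma>\<^sup>3\<close> of the claimed bound; the square root is only needed to be nonnegative.
\<close>

section \<open>Stein's equation for the normal distribution\<close>

abbreviation normal_cdf :: "real \<Rightarrow> real" where
  "normal_cdf \<equiv> cdf std_normal_distribution"

interpretation std_normal: real_distribution std_normal_distribution
  by (rule real_dist_normal_dist)

text \<open>Fundamental theorem of calculus: around \<open>x\<close> the distribution function is a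
  constant plus the integral of the continuous density from \<open>x - 1\<close>.\<close>

lemma normal_cdf_deriv: "(normal_cdf has_real_derivative std_normal_density x) (at x)"
proof -
  define a b where "a = x - 1" and "b = x + 1"
  have cont: "continuous_on S std_normal_density" for S
    unfolding normal_density_def by (intro continuous_intros) auto
  have eq: "normal_cdf y = normal_cdf a + integral {a..y} std_normal_density" if "a < y" for y
  proof -
    have int: "set_integrable lborel {a..y} std_normal_density"
      by (intro borel_integrable_atLeastAtMost' cont)
    have "normal_cdf y - normal_cdf a = measure std_normal_distribution {a<..y}"
      by (rule std_normal.cdf_diff_eq[OF that])
    also have "\<dots> = measure std_normal_distribution {a..y}"
    proof -
      have "emeasure std_normal_distribution {a} = 0"
        by (subst emeasure_density) (auto simp: nn_integral_indicator_singleton)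
      then have "{a} \<in> null_sets std_normal_distribution"
        by (auto simp: null_sets_def)
      then have "measure std_normal_distribution ({a<..y} \<union> {a}) = measure std_normal_distribution {a<..y}"
        by (intro measure_Un_null_set) auto
      moreover have "{a<..y} \<union> {a} = {a..y}" using that by auto
      ultimately show ?thesis by simp
    qed
    also have "\<dots> = integral\<^sup>L std_normal_distribution (indicator {a..y})"
      by simp
    also have "\<dots> = set_lebesgue_integral lborel {a..y} std_normal_density"
      by (subst integral_density) (auto simp: set_lebesgue_integral_def mult.commute)
    also have "\<dots> = integral {a..y} std_normal_density"
      by (rule set_borel_integral_eq_integral(2)[OF int])
    finally show ?thesis by simp
  qed
  have "((\<lambda>y. normal_cdf a + integral {a..y} std_normal_density) has_real_derivative
      std_normal_density x) (at x within {a..b})"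
    using integral_has_real_derivative[OF cont, of x a b] 
    by (auto intro!: derivative_eq_intros simp: a_def b_def)
  then have der: "((\<lambda>y. normal_cdf a + integral {a..y} std_normal_density) has_real_derivative
      std_normal_density x) (at x)"
    by (subst (asm) at_within_interior) (auto simp: a_def b_def)
  have ev: "\<forall>\<^sub>F y in nhds x. normal_cdf y = normal_cdf a + integral {a..y} std_normal_density"
    by (rule eventually_nhds_in_open[of "{a<..}", THEN eventually_mono])
       (auto simp: a_def intro!: eq[unfolded a_def])
  show ?thesis
    by (rule DERIV_cong_ev[OF refl ev refl, THEN iffD2, OF der])
qed

lemma std_normal_density_deriv:
  "(std_normal_density has_real_derivative - x * std_normal_density x) (at x)"
proof -
  have "((\<lambda>x. exp (- x\<^sup>2 / 2)) has_real_derivative exp (- x\<^sup>2 / 2) * (- x)) (at x)"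
    by (auto intro!: derivative_eq_intros)
  from DERIV_cmult[OF this, of "1 / sqrt (2 * pi)"] show ?thesis
    unfolding std_normal_density_def[abs_def] by (simp add: mult_ac)
qed

lemma std_normal_density_positive: "0 < std_normal_density x"
  by (rule normal_density_pos) simp

lemma normal_cdf_le_1: "normal_cdf x \<le> 1"
  by (rule std_normal.cdf_bounded_prob)

text \<open>The density is even, so \<open>?h\<close> has derivative zero; its constant value is
  read off at infinity.\<close>

lemma normal_cdf_uminus: "normal_cdf (- x) = 1 - normal_cdf x"
proof -
  let ?h = "\<lambda>x. normal_cdf x + normal_cdf (- x)"
  have der: "(?h has_real_derivative 0) (at y)" for y
  proof -
    have "((\<lambda>x. normal_cdf (- x)) has_real_derivative std_normal_density (- y) * (-1)) (at y)"
      by (rule DERIV_chain'[where f = uminus and g = normal_cdf])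
        (auto intro!: derivative_eq_intros normal_cdf_deriv)
    then have "(?h has_real_derivative std_normal_density y + std_normal_density (- y) * (-1)) (at y)"
      by (intro DERIV_add normal_cdf_deriv)
    then show ?thesis by (simp add: std_normal_density_def)
  qed
  have "?h y = ?h x" for y
    using DERIV_isconst_all[of ?h] der by blast
  then obtain c where const: "\<And>y. ?h y = c"
    by blast
  have "((\<lambda>y. normal_cdf (- y)) \<longlongrightarrow> 0) at_top"
    using std_normal.cdf_lim_at_bot by (simp add: filterlim_at_bot_mirror)
  then have "(?h \<longlongrightarrow> 1 + 0) at_top"
    by (intro tendsto_add std_normal.cdf_lim_at_top_prob)
  then have "c = 1"
    by (simp add: const tendsto_const_iff)
  with const[of x] show ?thesis by simp
qed

section \<open>Gaussian tail estimates and the Mills ratio\<close>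

lemma nonneg_if_deriv_nonpos_if_lim_0:
  fixes f f' :: "real \<Rightarrow> real"
  assumes der: "\<And>x. a \<le> x \<Longrightarrow> (f has_real_derivative f' x) (at x)"
    and le: "\<And>x. a \<le> x \<Longrightarrow> f' x \<le> 0"
    and lim: "(f \<longlongrightarrow> 0) at_top"
  shows "0 \<le> f a"
proof (rule tendsto_upperbound[OF lim])
  \<comment> \<open>The function is nonincreasing from \<open>a\<close> on, so \<open>f a\<close>
    bounds its limit 0 from above. This reduces the tail inequalities below to signs of
    derivatives.\<close>
  show "\<forall>\<^sub>F x in at_top. f x \<le> f a"
    using eventually_ge_at_top[of a]
  proof eventually_elim
    case (elim x)
    then show ?case
      by (rule DERIV_nonpos_imp_nonincreasing) (use der le in force)
  qed
qed simp

lemma power_times_exp_square_tendsto_0: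
  "((\<lambda>x. x ^ k * exp (- x\<^sup>2 / 2)) \<longlongrightarrow> 0) (at_top :: real filter)"
proof (rule tendsto_sandwich[OF _ _ tendsto_const tendsto_power_div_exp_0])
  show "\<forall>\<^sub>F x::real in at_top. 0 \<le> x ^ k * exp (- x\<^sup>2 / 2)"
    using eventually_ge_at_top[of 0] by eventually_elim simp
  show "\<forall>\<^sub>F x::real in at_top. x ^ k * exp (- x\<^sup>2 / 2) \<le> x ^ k / exp x"
    using eventually_ge_at_top[of 2]
  proof eventually_elim
    case (elim x)
    then have "2 * x \<le> x * x" by (intro mult_right_mono) auto
    then have "exp (- x\<^sup>2 / 2) \<le> exp (- x)" by (simp add: power2_eq_square)
    then have "x ^ k * exp (- x\<^sup>2 / 2) \<le> x ^ k * exp (- x)"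
      using elim by (intro mult_left_mono) auto
    then show ?case by (simp only: exp_minus divide_inverse)
  qed
qed

text \<open>Crude, but enough to show that the tail beats every power; this supplies the limits at
  infinity for the bounds on the Mills ratio.\<close>

lemma normal_tail_le_exp:
  assumes "1 \<le> x"
  shows "1 - normal_cdf x \<le> exp (- x\<^sup>2 / 2)"
proof -
  have "0 \<le> exp (- x\<^sup>2 / 2) - (1 - normal_cdf x)"
  proof (rule nonneg_if_deriv_nonpos_if_lim_0[where
        f = "\<lambda>y. exp (- y\<^sup>2 / 2) - (1 - normal_cdf y)"])
    fix y assume "x \<le> y"
    show "((\<lambda>y. exp (- y\<^sup>2 / 2) - (1 - normal_cdf y)) has_real_derivative
        - y * exp (- y\<^sup>2 / 2) + std_normal_density y) (at y)"
      by (auto intro!: derivative_eq_intros normal_cdf_deriv)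
    have "1 / sqrt (2 * pi) \<le> 1"
      using pi_ge_two by (simp add: real_le_lsqrt divide_le_eq_1)
    also have "1 \<le> y" using assms \<open>x \<le> y\<close> by simp
    finally have "1 / sqrt (2 * pi) * exp (- y\<^sup>2 / 2) \<le> y * exp (- y\<^sup>2 / 2)"
      by (intro mult_right_mono) auto
    then show "- y * exp (- y\<^sup>2 / 2) + std_normal_density y \<le> 0"
      by (simp add: std_normal_density_def)
  next
    have "((\<lambda>y. exp (- y\<^sup>2 / 2)) \<longlongrightarrow> 0) (at_top :: real filter)"
      using power_times_exp_square_tendsto_0[of 0] by simp
    then have "((\<lambda>y. exp (- y\<^sup>2 / 2) - (1 - normal_cdf y)) \<longlongrightarrow> 0 - (1 - 1)) at_top"
      by (intro tendsto_diff tendsto_const std_normal.cdf_lim_at_top_prob)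
    then show "((\<lambda>y. exp (- y\<^sup>2 / 2) - (1 - normal_cdf y)) \<longlongrightarrow> 0) at_top"
      by simp
  qed
  then show ?thesis by simp
qed

lemma normal_tail_power_tendsto_0: "((\<lambda>x. x ^ k * (1 - normal_cdf x)) \<longlongrightarrow> 0) at_top"
proof (rule tendsto_sandwich[OF _ _ tendsto_const])
  show "\<forall>\<^sub>F x in at_top. 0 \<le> x ^ k * (1 - normal_cdf x)"
    using eventually_ge_at_top[of 0] by eventually_elim (simp add: normal_cdf_le_1)
  show "\<forall>\<^sub>F x in at_top. x ^ k * (1 - normal_cdf x) \<le> x ^ k * exp (- x\<^sup>2 / 2)"
    using eventually_ge_at_top[of 1]
    by eventually_elim (intro mult_left_mono normal_tail_le_exp, auto)
qed (rule power_times_exp_square_tendsto_0)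

lemma std_normal_density_power_tendsto_0: "((\<lambda>x. x ^ k * std_normal_density x) \<longlongrightarrow> 0) at_top"
  using tendsto_mult_right[OF power_times_exp_square_tendsto_0, of k "1 / sqrt (2 * pi)"]
  by (simp add: std_normal_density_def mult_ac)

text \<open>The Mills ratio of the standard normal law. It solves \<open>y' = x * y - 1\<close>, and
  both branches of the solution of Stein's equation are multiples of it or of its
  reflection.\<close>

definition mills :: "real \<Rightarrow> real" where
  "mills x = (1 - normal_cdf x) / std_normal_density x"

lemma mills_uminus: "mills (- x) = normal_cdf x / std_normal_density x"
proof -
  have "std_normal_density (- x) = std_normal_density x"
    by (simp add: std_normal_density_def)
  then show ?thesis by (simp only: mills_def normal_cdf_uminus) simp
qed

lemma mills_deriv: "(mills has_real_derivative x * mills x - 1) (at x)"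
proof -
  have pos: "std_normal_density x > 0" by (rule std_normal_density_positive)
  have "(mills has_real_derivative
     ((0 - std_normal_density x) * std_normal_density x
       - (1 - normal_cdf x) * (- x * std_normal_density x)) / (std_normal_density x * std_normal_density x)) (at x)"
    unfolding mills_def[abs_def] using pos
    by (intro DERIV_divide DERIV_diff DERIV_const normal_cdf_deriv std_normal_density_deriv) auto
  moreover have "((0 - std_normal_density x) * std_normal_density x
       - (1 - normal_cdf x) * (- x * std_normal_density x)) / (std_normal_density x * std_normal_density x)
     = x * mills x - 1"
    using pos by (simp add: mills_def field_simps)
  ultimately show ?thesis by simp
qed

text \<open>The difference of the density and \<open>y * (1 - normal_cdf y)\<close> has minus the
  tail as derivative and vanishes at infinity.\<close>

lemma mills_upper: "x * mills x \<le> 1"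
proof -
  have A: "0 \<le> std_normal_density x - x * (1 - normal_cdf x)"
  proof (rule nonneg_if_deriv_nonpos_if_lim_0[where
        f = "\<lambda>y. std_normal_density y - y * (1 - normal_cdf y)"])
    fix y
    show "((\<lambda>y. std_normal_density y - y * (1 - normal_cdf y)) has_real_derivative
        - (1 - normal_cdf y)) (at y)"
      by (auto intro!: derivative_eq_intros normal_cdf_deriv std_normal_density_deriv
          simp: algebra_simps)
    show "- (1 - normal_cdf y) \<le> 0" by (simp add: normal_cdf_le_1)
  next
    show "((\<lambda>y. std_normal_density y - y * (1 - normal_cdf y)) \<longlongrightarrow> 0) at_top"
      using tendsto_diff[OF std_normal_density_power_tendsto_0[of 0] normal_tail_power_tendsto_0[of 1]]
      by simp
  qed
  then show ?thesis
    using std_normal_density_positive[of x] by (simp add: mills_def divide_le_eq_1)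
qed

text \<open>This is nonnegativity of the derivative of \<open>x * mills x\<close>. The method is the
  same, with \<open>mills_upper\<close> giving the sign of the derivative.\<close>

lemma mills_lower: "x \<le> (1 + x\<^sup>2) * mills x"
proof -
  have A: "0 \<le> (1 + x\<^sup>2) * (1 - normal_cdf x) - x * std_normal_density x"
  proof (rule nonneg_if_deriv_nonpos_if_lim_0[where
        f = "\<lambda>y. (1 + y\<^sup>2) * (1 - normal_cdf y) - y * std_normal_density y"])
    fix y
    show "((\<lambda>y. (1 + y\<^sup>2) * (1 - normal_cdf y) - y * std_normal_density y) has_real_derivative
        2 * (y * (1 - normal_cdf y) - std_normal_density y)) (at y)"
      by (auto intro!: derivative_eq_intros normal_cdf_deriv std_normal_density_deriv
          simp: algebra_simps power2_eq_square)
    have "y * (1 - normal_cdf y) \<le> std_normal_density y"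
      using mills_upper[of y] std_normal_density_positive[of y]
      by (simp add: mills_def divide_le_eq_1)
    then show "2 * (y * (1 - normal_cdf y) - std_normal_density y) \<le> 0" by simp
  next
    have "((\<lambda>y. y ^ 0 * (1 - normal_cdf y) + y ^ 2 * (1 - normal_cdf y)
        - y ^ 1 * std_normal_density y) \<longlongrightarrow> 0 + 0 - 0) at_top"
      by (intro tendsto_diff tendsto_add normal_tail_power_tendsto_0 std_normal_density_power_tendsto_0)
    then show "((\<lambda>y. (1 + y\<^sup>2) * (1 - normal_cdf y) - y * std_normal_density y) \<longlongrightarrow> 0) at_top"
      by (simp add: algebra_simps)
  qed
  then show ?thesis
    using std_normal_density_positive[of x] by (simp add: mills_def pos_le_divide_eq)
qed

lemma mono_times_mills: "mono (\<lambda>x. x * mills x)"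
proof (rule monoI)
  fix x y :: real assume "x \<le> y"
  then show "x * mills x \<le> y * mills y"
  proof (rule DERIV_nonneg_imp_nondecreasing)
    fix t
    have "((\<lambda>x. x * mills x) has_real_derivative (1 + t\<^sup>2) * mills t - t) (at t)"
      by (auto intro!: derivative_eq_intros mills_deriv simp: algebra_simps power2_eq_square)
    then show "\<exists>d. ((\<lambda>x. x * mills x) has_real_derivative d) (at t) \<and> d \<ge> 0"
      using mills_lower[of t] by force
  qed
qed

section \<open>The bounded solution of Stein's equation for the indicator of a half-line\<close>

definition stein_sol :: "real \<Rightarrow> real \<Rightarrow> real" where
  "stein_sol z w = (if w \<le> z then (1 - normal_cdf z) * mills (- w) else normal_cdf z * mills w)"

text \<open>Stein's equation solved for the derivative, so that the equation holds at every point by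
  definition. At the kink \<open>w = z\<close> the value is the derivative from the left.\<close>

definition stein_deriv :: "real \<Rightarrow> real \<Rightarrow> real" where
  "stein_deriv z w = w * stein_sol z w + (if w \<le> z then 1 else 0) - normal_cdf z"

lemma stein_sol_eq_right: "z \<le> w \<Longrightarrow> stein_sol z w = normal_cdf z * mills w"
  unfolding stein_sol_def by (cases "w = z") (simp_all only: mills_uminus mills_def[of z], simp_all)

text \<open>Each branch is a nonnegative multiple of \<open>x * mills x\<close>, reflected in
  argument and sign on the left; the branches agree at \<open>z\<close>.\<close>

lemma times_stein_sol_mono: "mono (\<lambda>w. w * stein_sol z w)"
proof (rule monoI)
  have left: "x * stein_sol z x \<le> y * stein_sol z y" if "x \<le> y" "y \<le> z" for x y
  proof -
    have "(1 - normal_cdf z) * ((- y) * mills (- y)) \<le> (1 - normal_cdf z) * ((- x) * mills (- x))"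
      using monoD[OF mono_times_mills, of "- y" "- x"] that
      by (intro mult_left_mono) (auto simp: normal_cdf_le_1)
    then show ?thesis using that by (simp add: stein_sol_def algebra_simps)
  qed
  have right: "x * stein_sol z x \<le> y * stein_sol z y" if "x \<le> y" "z \<le> x" for x y
  proof -
    have "normal_cdf z * (x * mills x) \<le> normal_cdf z * (y * mills y)"
      using monoD[OF mono_times_mills, of x y] that
      by (intro mult_left_mono) (auto simp: std_normal.cdf_nonneg)
    then show ?thesis using that by (simp add: stein_sol_eq_right algebra_simps)
  qed
  fix x y :: real assume "x \<le> y"
  then show "x * stein_sol z x \<le> y * stein_sol z y"
    using left[of x y] right[of x y] left[of x z] right[of z y] by linarith
qed

text \<open>The bounds lie exactly 1 apart, which is the oscillation that enters the covariance
  estimate later. Each comes from \<open>mills_upper\<close> on one side of \<open>z\<close> and is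
  carried to the other side by monotonicity.\<close>

lemma times_stein_sol_bounds:
  "- (1 - normal_cdf z) \<le> w * stein_sol z w" "w * stein_sol z w \<le> normal_cdf z"
proof -
  have lo: "- (1 - normal_cdf z) \<le> w * stein_sol z w" if "w \<le> z" for w
    using mult_left_mono[OF mills_upper[of "- w"], of "1 - normal_cdf z"] that normal_cdf_le_1[of z]
    by (simp add: stein_sol_def algebra_simps)
  have hi: "w * stein_sol z w \<le> normal_cdf z" if "z \<le> w" for w
    using mult_left_mono[OF mills_upper[of w], of "normal_cdf z"] that std_normal.cdf_nonneg[of z]
    by (simp add: stein_sol_eq_right algebra_simps)
  show "- (1 - normal_cdf z) \<le> w * stein_sol z w"
    using lo[of w] lo[of z] monoD[OF times_stein_sol_mono[of z], of z w] by force
  show "w * stein_sol z w \<le> normal_cdf z"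
    using hi[of w] hi[of z] monoD[OF times_stein_sol_mono[of z], of w z] by force
qed

lemma stein_deriv_abs_le_1: "\<bar>stein_deriv z w\<bar> \<le> 1"
  using times_stein_sol_bounds(1)[of z w] times_stein_sol_bounds(2)[of w z] normal_cdf_le_1[of z] std_normal.cdf_nonneg[of z]
  by (auto simp: stein_deriv_def)

lemma continuous_on_mills: "continuous_on UNIV mills"
  using mills_deriv DERIV_isCont by (intro continuous_at_imp_continuous_on) blast

lemma stein_sol_has_deriv:
  assumes "w \<noteq> z"
  shows "(stein_sol z has_real_derivative stein_deriv z w) (at w)"
proof (cases "w < z")
  case True
  have "((\<lambda>x. mills (- x)) has_real_derivative (- w * mills (- w) - 1) * (-1)) (at w)"
    by (rule DERIV_chain'[where f = uminus and g = mills])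
      (auto intro!: derivative_eq_intros mills_deriv[of "-w", simplified])
  from DERIV_cmult[OF this, of "1 - normal_cdf z"]
  have "((\<lambda>x. (1 - normal_cdf z) * mills (- x)) has_real_derivative stein_deriv z w) (at w)"
    using True by (simp add: stein_deriv_def stein_sol_def algebra_simps)
  moreover have "\<forall>\<^sub>F x in nhds w. stein_sol z x = (1 - normal_cdf z) * mills (- x)"
    by (rule eventually_nhds_in_open[of "{..<z}", THEN eventually_mono])
       (auto simp: stein_sol_def True)
  ultimately show ?thesis
    by (subst DERIV_cong_ev[OF refl _ refl]) auto
next
  case False
  with assms have "z < w" by simp
  from DERIV_cmult[OF mills_deriv, of "normal_cdf z" w]
  have "((\<lambda>x. normal_cdf z * mills x) has_real_derivative stein_deriv z w) (at w)"
    using \<open>z < w\<close> by (simp add: stein_deriv_def stein_sol_def algebra_simps)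
  moreover have "\<forall>\<^sub>F x in nhds w. stein_sol z x = normal_cdf z * mills x"
    by (rule eventually_nhds_in_open[of "{z<..}", THEN eventually_mono])
       (auto simp: stein_sol_def \<open>z < w\<close>)
  ultimately show ?thesis
    by (subst DERIV_cong_ev[OF refl _ refl]) auto
qed

lemma isCont_stein_sol: "isCont (stein_sol z) w"
proof (cases "w = z")
  case False
  then show ?thesis using stein_sol_has_deriv DERIV_isCont by blast
next
  case True
  have 1: "continuous_on {..z} (stein_sol z)"
  proof -
    have "continuous_on {..z} (\<lambda>x. (1 - normal_cdf z) * mills (- x))"
      by (intro continuous_on_mult_left continuous_on_compose2[OF continuous_on_mills]
          continuous_on_minus continuous_on_id) auto
    then show ?thesis by (rule continuous_on_eq) (auto simp: stein_sol_def)
  qed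
  have 2: "continuous_on {z..} (stein_sol z)"
  proof -
    have "continuous_on {z..} (\<lambda>x. normal_cdf z * mills x)"
      by (intro continuous_on_mult_left continuous_on_subset[OF continuous_on_mills]) auto
    then show ?thesis by (rule continuous_on_eq) (auto simp: stein_sol_eq_right)
  qed
  have "continuous_on ({..z} \<union> {z..}) (stein_sol z)"
    by (rule continuous_on_closed_Un[OF _ _ 1 2]) auto
  moreover have "{..z} \<union> {z..} = (UNIV :: real set)" by auto
  ultimately show ?thesis by (simp add: continuous_on_eq_continuous_at)
qed

text \<open>The mean value theorem on either side of \<open>z\<close>, where the derivative may fail
  to exist.\<close>

lemma increment_bounds_except_point:
  fixes f f' :: "real \<Rightarrow> real"
  assumes "x \<le> y" and cont: "\<And>w. isCont f w"
    and der: "\<And>w. w \<noteq> z \<Longrightarrow> (f has_real_derivative f' w) (at w)"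
    and bnd: "\<And>w. x \<le> w \<Longrightarrow> w \<le> y \<Longrightarrow> l \<le> f' w \<and> f' w \<le> u"
  shows "(y - x) * l \<le> f y - f x \<and> f y - f x \<le> (y - x) * u"
proof -
  have step: "(b - a) * l \<le> f b - f a \<and> f b - f a \<le> (b - a) * u"
    if "x \<le> a" "a \<le> b" "b \<le> y" "z \<notin> {a<..<b}" for a b
  proof (cases "a < b")
    case True
    have "continuous_on {a..b} f"
      using cont by (simp add: continuous_at_imp_continuous_on)
    moreover have "\<And>w. a < w \<Longrightarrow> w < b \<Longrightarrow> (f has_real_derivative f' w) (at w)"
      using that by (intro der) auto
    ultimately obtain t where "a < t" "t < b" "f b - f a = (b - a) * f' t"
      using mvt[OF True, of f "\<lambda>w. (*) (f' w)"] 
      by (auto simp: has_field_derivative_def mult.commute)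
    with bnd[of t] that show ?thesis by (auto intro!: mult_left_mono)
  qed (use that in auto)
  show ?thesis
  proof (cases "z \<in> {x<..<y}")
    case True
    with step[of x z] step[of z y] show ?thesis by (auto simp: algebra_simps)
  next
    case False
    with step[of x y] assms show ?thesis by auto
  qed
qed

text \<open>The derivative of the solution is a difference of two monotone functions, which gives a
  remainder estimate that is monotone in both end points and needs no concentration inequality.\<close>

lemma stein_sol_increment:
  fixes z :: real
  defines "h \<equiv> \<lambda>w. if z < w then 1 else 0 :: real"
  shows "- ((x - y) * (x * stein_sol z x - y * stein_sol z y))
           \<le> stein_sol z x - stein_sol z y - (x - y) * stein_deriv z x"
    and "stein_sol z x - stein_sol z y - (x - y) * stein_deriv z x \<le> (x - y) * (h x - h y)"
proof -
  let ?g = "\<lambda>w. w * stein_sol z w" and ?c = "1 - normal_cdf z"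
  have d: "stein_deriv z w = ?g w - h w + ?c" for w
    by (simp add: stein_deriv_def h_def)
  have h_mono: "h a \<le> h b" if "a \<le> b" for a b using that by (auto simp: h_def)
  have inc: "(b - a) * (?g a - h b + ?c) \<le> stein_sol z b - stein_sol z a \<and>
             stein_sol z b - stein_sol z a \<le> (b - a) * (?g b - h a + ?c)" if "a \<le> b" for a b
  proof (rule increment_bounds_except_point[OF that, where z = z and f' = "stein_deriv z"])
    fix w assume "a \<le> w" "w \<le> b"
    then show "?g a - h b + ?c \<le> stein_deriv z w \<and> stein_deriv z w \<le> ?g b - h a + ?c"
      using monoD[OF times_stein_sol_mono[of z], of a w] monoD[OF times_stein_sol_mono[of z], of w b]
        h_mono[of a w] h_mono[of w b] by (simp add: d)
  qed (auto intro: isCont_stein_sol stein_sol_has_deriv)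
  \<comment> \<open>In each estimate one of the two monotone parts cancels against
    \<open>stein_deriv z x\<close>, which leaves the increment of the other.\<close>
  show "- ((x - y) * (?g x - ?g y)) \<le> stein_sol z x - stein_sol z y - (x - y) * stein_deriv z x"
    and "stein_sol z x - stein_sol z y - (x - y) * stein_deriv z x \<le> (x - y) * (h x - h y)"
    using inc[of x y] inc[of y x] unfolding d by (cases "x \<le> y"; simp add: algebra_simps)+
qed

section \<open>Bounded differences of random permutations\<close>

definition mean :: "'a set \<Rightarrow> ('a \<Rightarrow> real) \<Rightarrow> real" where
  "mean A f = (\<Sum>x\<in>A. f x) / real (card A)"

lemma mean_cong: "(\<And>x. x \<in> A \<Longrightarrow> f x = g x) \<Longrightarrow> mean A f = mean A g"
  by (simp add: mean_def)

lemma mean_const: "finite A \<Longrightarrow> A \<noteq> {} \<Longrightarrow> mean A (\<lambda>_. c) = c"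
  by (simp add: mean_def)

lemma mean_add: "mean A (\<lambda>x. f x + g x) = mean A f + mean A g"
  by (simp add: mean_def sum.distrib add_divide_distrib)

lemma mean_diff: "mean A (\<lambda>x. f x - g x) = mean A f - mean A g"
  by (simp add: mean_def sum_subtractf diff_divide_distrib)

lemma mean_cmult: "mean A (\<lambda>x. c * f x) = c * mean A f"
  by (simp add: mean_def sum_distrib_left)

lemma mean_sum: "mean A (\<lambda>x. \<Sum>i\<in>I. f i x) = (\<Sum>i\<in>I. mean A (f i))"
  by (subst mean_def, subst sum.swap) (simp add: mean_def sum_divide_distrib)

lemma mean_mono: "(\<And>x. x \<in> A \<Longrightarrow> f x \<le> g x) \<Longrightarrow> mean A f \<le> mean A g"
  by (simp add: mean_def divide_right_mono sum_mono)

lemma mean_nonneg: "(\<And>x. x \<in> A \<Longrightarrow> 0 \<le> f x) \<Longrightarrow> 0 \<le> mean A f"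
  by (simp add: mean_def sum_nonneg)

lemma abs_mean_le: "\<bar>mean A f\<bar> \<le> mean A (\<lambda>x. \<bar>f x\<bar>)"
  by (simp add: mean_def divide_right_mono sum_abs)

text \<open>Bias-variance decomposition. It shows that the mean is the best centre and also serves
  as the law of total variance, applied conditionally.\<close>

lemma mean_square_shift:
  assumes "finite A" "A \<noteq> {}"
  shows "mean A (\<lambda>x. (f x - c)\<^sup>2) = mean A (\<lambda>x. (f x - mean A f)\<^sup>2) + (mean A f - c)\<^sup>2"
proof -
  define \<mu> where "\<mu> = mean A f"
  have "mean A (\<lambda>x. (f x - c)\<^sup>2)
      = mean A (\<lambda>x. (f x - \<mu>)\<^sup>2 + (2 * (\<mu> - c) * (f x - \<mu>) + (\<mu> - c)\<^sup>2))"
    by (rule mean_cong) (simp add: power2_eq_square algebra_simps)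
  also have "\<dots> = mean A (\<lambda>x. (f x - \<mu>)\<^sup>2) + (\<mu> - c)\<^sup>2"
    using assms by (simp add: mean_add mean_cmult mean_diff mean_const \<mu>_def)
  finally show ?thesis by (simp add: \<mu>_def)
qed

text \<open>Popoviciu's inequality: replacing the mean by the midpoint of the range can only
  increase the second moment, and no value is farther than \<open>c / 2\<close> from that
  midpoint.\<close>

lemma mean_square_dev_le:
  assumes "finite A" "A \<noteq> {}" and le: "\<And>x y. x \<in> A \<Longrightarrow> y \<in> A \<Longrightarrow> \<bar>f x - f y\<bar> \<le> c"
  shows "mean A (\<lambda>x. (f x - mean A f)\<^sup>2) \<le> c\<^sup>2 / 4"
proof -
  define lo hi where "lo = Min (f ` A)" and "hi = Max (f ` A)"
  have fin: "finite (f ` A)" "f ` A \<noteq> {}" using assms by auto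
  obtain x y where xy: "x \<in> A" "lo = f x" "y \<in> A" "hi = f y"
    using Min_in[OF fin] Max_in[OF fin] unfolding lo_def hi_def by auto
  have "hi - lo \<le> c" using le[of y x] xy by auto
  have "(f t - (lo + hi) / 2)\<^sup>2 \<le> c\<^sup>2 / 4" if "t \<in> A" for t
  proof -
    have "lo \<le> f t" "f t \<le> hi" using fin that by (auto simp: lo_def hi_def)
    with \<open>hi - lo \<le> c\<close> have "\<bar>f t - (lo + hi) / 2\<bar> \<le> \<bar>c / 2\<bar>" by (simp add: field_simps)
    then have "(f t - (lo + hi) / 2)\<^sup>2 \<le> (c / 2)\<^sup>2" by (simp only: abs_le_square_iff)
    then show ?thesis by (simp add: power_divide)
  qed
  then have "mean A (\<lambda>t. (f t - (lo + hi) / 2)\<^sup>2) \<le> mean A (\<lambda>_. c\<^sup>2 / 4)"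
    by (rule mean_mono)
  then show ?thesis
    using mean_square_shift[OF assms(1,2), of f "(lo + hi) / 2"] assms
    by (simp add: mean_const) (smt (verit) zero_le_power2)
qed

lemma mean_PiE_insert:
  assumes "finite I" "i \<notin> I" "finite B"
  shows "mean (insert i I \<rightarrow>\<^sub>E B) f = mean (I \<rightarrow>\<^sub>E B) (\<lambda>g. mean B (\<lambda>y. f (g(i := y))))"
proof -
  have "sum f (insert i I \<rightarrow>\<^sub>E B) = (\<Sum>(y, g)\<in>B \<times> (I \<rightarrow>\<^sub>E B). f (g(i := y)))"
    by (subst PiE_insert_eq, subst sum.reindex[OF inj_combinator[OF assms(2)]])
      (auto intro!: sum.cong)
  also have "\<dots> = (\<Sum>g\<in>I \<rightarrow>\<^sub>E B. \<Sum>y\<in>B. f (g(i := y)))"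
    by (subst sum.cartesian_product[symmetric], subst sum.swap) simp
  finally show ?thesis
    using assms by (simp add: mean_def card_funcsetE sum_divide_distrib[symmetric] mult.commute)
qed

text \<open>An Efron-Stein bound by induction on the coordinates. The centre \<open>m\<close> is
  existential because it is simply inherited from the smaller index set; any centre serves later,
  since the mean minimises the second moment.\<close>

lemma bounded_differences_PiE:
  fixes f :: "('i \<Rightarrow> 'b) \<Rightarrow> real"
  assumes "finite I" and B: "finite B" "B \<noteq> {}"
    and "\<And>i x y. i \<in> I \<Longrightarrow> x \<in> I \<rightarrow>\<^sub>E B \<Longrightarrow> y \<in> I \<rightarrow>\<^sub>E B \<Longrightarrow> (\<And>j. j \<noteq> i \<Longrightarrow> x j = y j) \<Longrightarrow>
      \<bar>f x - f y\<bar> \<le> c i"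
  shows "\<exists>m. mean (I \<rightarrow>\<^sub>E B) (\<lambda>x. (f x - m)\<^sup>2) \<le> (\<Sum>i\<in>I. (c i)\<^sup>2) / 4"
  using assms(1,4)
proof (induction I arbitrary: f rule: finite_induct)
  case empty
  show ?case by (rule exI[of _ "f (\<lambda>_. undefined)"]) (simp add: mean_def)
next
  case (insert i I)
  have upd: "g(i := y) \<in> insert i I \<rightarrow>\<^sub>E B" if "g \<in> I \<rightarrow>\<^sub>E B" "y \<in> B" for g y
    using that by (auto simp: PiE_insert_eq)
  define F where "F g = mean B (\<lambda>y. f (g(i := y)))" for g
  \<comment> \<open>Averaging out coordinate \<open>i\<close> preserves the bounded differences in
    the remaining coordinates.\<close>
  have F: "\<bar>F x - F y\<bar> \<le> c j" if j: "j \<in> I" and x: "x \<in> I \<rightarrow>\<^sub>E B" and y: "y \<in> I \<rightarrow>\<^sub>E B"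
    and eq: "\<And>k. k \<noteq> j \<Longrightarrow> x k = y k" for j x y
  proof -
    have "\<bar>F x - F y\<bar> \<le> mean B (\<lambda>t. \<bar>f (x(i := t)) - f (y(i := t))\<bar>)"
      unfolding F_def mean_diff[symmetric] by (rule abs_mean_le)
    also have "\<dots> \<le> mean B (\<lambda>_. c j)"
    proof (rule mean_mono)
      fix t assume "t \<in> B"
      then show "\<bar>f (x(i := t)) - f (y(i := t))\<bar> \<le> c j"
        using j eq by (intro insert.prems upd x y) auto
    qed
    finally show ?thesis using B by (simp add: mean_const)
  qed
  have "\<exists>m. mean (I \<rightarrow>\<^sub>E B) (\<lambda>x. (F x - m)\<^sup>2) \<le> (\<Sum>i\<in>I. (c i)\<^sup>2) / 4"
    by (rule insert.IH) (rule F)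
  then obtain m where m: "mean (I \<rightarrow>\<^sub>E B) (\<lambda>x. (F x - m)\<^sup>2) \<le> (\<Sum>i\<in>I. (c i)\<^sup>2) / 4" ..
  \<comment> \<open>Law of total variance: for fixed \<open>g\<close> the second moment about
    \<open>m\<close> splits at the conditional mean \<open>F g\<close>, and Popoviciu's inequality
    bounds the first part.\<close>
  have "mean (insert i I \<rightarrow>\<^sub>E B) (\<lambda>x. (f x - m)\<^sup>2)
      = mean (I \<rightarrow>\<^sub>E B) (\<lambda>g. mean B (\<lambda>y. (f (g(i := y)) - F g)\<^sup>2) + (F g - m)\<^sup>2)"
    unfolding mean_PiE_insert[OF insert.hyps B(1)] F_def
    by (rule mean_cong) (rule mean_square_shift[OF B])
  also have "\<dots> \<le> mean (I \<rightarrow>\<^sub>E B) (\<lambda>g. (c i)\<^sup>2 / 4 + (F g - m)\<^sup>2)"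
  proof (intro mean_mono add_right_mono)
    fix g assume g: "g \<in> I \<rightarrow>\<^sub>E B"
    show "mean B (\<lambda>y. (f (g(i := y)) - F g)\<^sup>2) \<le> (c i)\<^sup>2 / 4"
      unfolding F_def by (intro mean_square_dev_le B insert.prems upd g) auto
  qed
  also have "\<dots> = (c i)\<^sup>2 / 4 + mean (I \<rightarrow>\<^sub>E B) (\<lambda>g. (F g - m)\<^sup>2)"
    using insert.hyps B by (simp add: mean_add mean_const finite_PiE PiE_eq_empty_iff)
  also have "\<dots> \<le> (\<Sum>i\<in>insert i I. (c i)\<^sup>2) / 4"
    using m insert.hyps by (simp add: add_divide_distrib)
  finally show ?case by blast
qed

section \<open>Ranks of grid points as random permutations\<close>

definition tie_less :: "(nat \<Rightarrow> nat) \<Rightarrow> nat \<Rightarrow> nat \<Rightarrow> bool" where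
  "tie_less U u v \<longleftrightarrow> U u < U v \<or> U u = U v \<and> u < v"

text \<open>As \<open>tie_less\<close> is a strict total order, counting the indices not above
  \<open>v\<close>, with \<open>v\<close> itself included, gives ranks from 1 to \<open>n\<close>.
  Outside \<open>{1..n}\<close> the identity is taken, as \<open>permutes\<close> demands.\<close>

definition tie_rank :: "nat \<Rightarrow> (nat \<Rightarrow> nat) \<Rightarrow> nat \<Rightarrow> nat" where
  "tie_rank n U v = (if v \<in> {1..n} then card {u \<in> {1..n}. \<not> tie_less U v u} else v)"

text \<open>If \<open>u\<close> precedes \<open>v\<close>, the set counted for \<open>u\<close> is a
  proper subset of that for \<open>v\<close>; trichotomy gives the converse. Hence the relative
  order of two ranks depends on the values at these two indices only.\<close>

lemma tie_rank_less_iff: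
  assumes "u \<in> {1..n}" "v \<in> {1..n}"
  shows "tie_rank n U u < tie_rank n U v \<longleftrightarrow> tie_less U u v"
proof -
  have less: "tie_rank n U x < tie_rank n U y"
    if "tie_less U x y" "x \<in> {1..n}" "y \<in> {1..n}" for x y
  proof -
    have "{w \<in> {1..n}. \<not> tie_less U x w} \<subset> {w \<in> {1..n}. \<not> tie_less U y w}"
      using that unfolding psubset_eq set_eq_iff by (auto simp: tie_less_def)
    then show ?thesis using that by (simp add: tie_rank_def psubset_card_mono)
  qed
  consider "tie_less U u v" | "tie_less U v u" | "u = v"
    unfolding tie_less_def by linarith
  then show ?thesis
  proof cases
    case 2
    then have "\<not> tie_less U u v" by (auto simp: tie_less_def)
    with less[OF 2] assms show ?thesis by auto
  qed (use less assms in \<open>auto simp: tie_less_def\<close>)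
qed

lemma tie_rank_permutes: "tie_rank n U permutes {1..n}"
proof (rule bij_imp_permutes)
  have inj: "inj_on (tie_rank n U) {1..n}"
  proof (rule inj_onI)
    fix u v assume uv: "u \<in> {1..n}" "v \<in> {1..n}" "tie_rank n U u = tie_rank n U v"
    then have "\<not> tie_less U u v" "\<not> tie_less U v u"
      using tie_rank_less_iff[of u n v U] tie_rank_less_iff[of v n u U] by auto
    then show "u = v" by (auto simp: tie_less_def)
  qed
  have "tie_rank n U v \<in> {1..n}" if v: "v \<in> {1..n}" for v
  proof -
    have "v \<in> {u \<in> {1..n}. \<not> tie_less U v u}" using v by (auto simp: tie_less_def)
    then have "card {u \<in> {1..n}. \<not> tie_less U v u} > 0"
      by (intro card_gt_0_iff[THEN iffD2]) auto
    moreover have "card {u \<in> {1..n}. \<not> tie_less U v u} \<le> card {1..n}"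
      by (intro card_mono) auto
    ultimately show ?thesis using v by (simp add: tie_rank_def)
  qed
  then have "tie_rank n U ` {1..n} \<subseteq> {1..n}" by blast
  then have "tie_rank n U ` {1..n} = {1..n}"
    using inj by (intro endo_inj_surj) auto
  with inj show "bij_betw (tie_rank n U) {1..n} {1..n}" by (simp add: bij_betw_def)
next
  fix v assume "v \<notin> {1..n}"
  then show "tie_rank n U v = v" unfolding tie_rank_def by (rule if_not_P)
qed

text \<open>Relabelling does not respect tie-breaking by index; for injective \<open>U\<close> the
  values alone decide the order.\<close>

lemma tie_rank_compose:
  assumes inj: "inj_on U {1..n}" and \<sigma>: "\<sigma> permutes {1..n}"
  shows "tie_rank n (U \<circ> \<sigma>) = tie_rank n U \<circ> \<sigma>"
proof
  fix v
  show "tie_rank n (U \<circ> \<sigma>) v = (tie_rank n U \<circ> \<sigma>) v"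
  proof (cases "v \<in> {1..n}")
    case True
    have less_iff: "tie_less (U \<circ> \<sigma>) v u \<longleftrightarrow> tie_less U (\<sigma> v) (\<sigma> u)" if "u \<in> {1..n}" for u
      using inj_onD[OF inj, of "\<sigma> v" "\<sigma> u"] permutes_in_image[OF \<sigma>] permutes_inj[OF \<sigma>] True that
      by (auto simp: tie_less_def inj_eq)
    have "bij_betw \<sigma> {u \<in> {1..n}. \<not> tie_less (U \<circ> \<sigma>) v u} {w \<in> {1..n}. \<not> tie_less U (\<sigma> v) w}"
    proof (rule bij_betw_imageI)
      show "inj_on \<sigma> {u \<in> {1..n}. \<not> tie_less (U \<circ> \<sigma>) v u}"
        using permutes_inj[OF \<sigma>] by (rule inj_on_subset) simp
      show "\<sigma> ` {u \<in> {1..n}. \<not> tie_less (U \<circ> \<sigma>) v u} = {w \<in> {1..n}. \<not> tie_less U (\<sigma> v) w}"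
      proof (intro equalityI subsetI)
        fix w assume "w \<in> {w \<in> {1..n}. \<not> tie_less U (\<sigma> v) w}"
        moreover then obtain u where "u \<in> {1..n}" "w = \<sigma> u"
          using permutes_image[OF \<sigma>] by blast
        ultimately show "w \<in> \<sigma> ` {u \<in> {1..n}. \<not> tie_less (U \<circ> \<sigma>) v u}"
          using less_iff by auto
      qed (use less_iff permutes_in_image[OF \<sigma>] in auto)
    qed
    from bij_betw_same_card[OF this] show ?thesis
      using True permutes_in_image[OF \<sigma>, of v] by (simp add: tie_rank_def)
  next
    case False
    then show ?thesis
      using permutes_not_in[OF \<sigma> False] by (simp only: comp_apply tie_rank_def if_False)
  qed
qed

text \<open>The injective grid points are closed under relabelling, so the law of their rank
  permutation is invariant under composition with any permutation, hence uniform.\<close>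

lemma sum_tie_rank_inj:
  fixes F :: "(nat \<Rightarrow> nat) \<Rightarrow> real" and n N :: nat
  defines "inj_grid \<equiv> {U \<in> {1..n} \<rightarrow>\<^sub>E {..<N}. inj_on U {1..n}}"
  shows "(\<Sum>U\<in>inj_grid. F (tie_rank n U)) = real (card inj_grid) * mean {\<pi>. \<pi> permutes {1..n}} F"
proof -
  let ?P = "{\<pi>. \<pi> permutes {1..n}}" and ?G = inj_grid
  have comp: "U \<circ> \<sigma> \<in> ?G" if U: "U \<in> ?G" and \<sigma>: "\<sigma> permutes {1..n}" for U \<sigma>
  proof -
    have "inj_on (U \<circ> \<sigma>) {1..n}"
      using U by (intro comp_inj_on permutes_inj_on[OF \<sigma>])
        (simp add: permutes_image[OF \<sigma>] inj_grid_def del: One_nat_def)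
    moreover have "U \<circ> \<sigma> \<in> {1..n} \<rightarrow>\<^sub>E {..<N}"
    proof (rule PiE_I)
      fix v assume "v \<in> {1..n}"
      then show "(U \<circ> \<sigma>) v \<in> {..<N}"
        using U permutes_in_image[OF \<sigma>, of v] unfolding inj_grid_def by fastforce
    next
      fix v assume "v \<notin> {1..n}"
      then show "(U \<circ> \<sigma>) v = undefined"
        using U permutes_not_in[OF \<sigma>, of v] unfolding inj_grid_def by fastforce
    qed
    ultimately show ?thesis by (simp add: inj_grid_def)
  qed
  have shift: "(\<Sum>U\<in>?G. F (tie_rank n U)) = (\<Sum>U\<in>?G. F (tie_rank n U \<circ> \<sigma>))"
    if \<sigma>: "\<sigma> permutes {1..n}" for \<sigma>
  proof (rule sum.reindex_bij_witness[where i = "\<lambda>U. U \<circ> \<sigma>" and j = "\<lambda>U. U \<circ> inv \<sigma>"])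
    fix U assume U: "U \<in> ?G"
    show "U \<circ> \<sigma> \<in> ?G" "U \<circ> inv \<sigma> \<in> ?G" using comp U \<sigma> permutes_inv by auto
    show "U \<circ> inv \<sigma> \<circ> \<sigma> = U" "U \<circ> \<sigma> \<circ> inv \<sigma> = U"
      by (simp_all add: comp_assoc permutes_inv_o[OF \<sigma>])
    have "tie_rank n (U \<circ> inv \<sigma>) = tie_rank n U \<circ> inv \<sigma>"
      using U permutes_inv[OF \<sigma>] by (intro tie_rank_compose) (auto simp: inj_grid_def)
    then show "F (tie_rank n (U \<circ> inv \<sigma>) \<circ> \<sigma>) = F (tie_rank n U)"
      by (simp add: comp_assoc permutes_inv_o[OF \<sigma>])
  qed
  have "(\<Sum>\<sigma>\<in>?P. \<Sum>U\<in>?G. F (tie_rank n U)) = (\<Sum>\<sigma>\<in>?P. \<Sum>U\<in>?G. F (tie_rank n U \<circ> \<sigma>))"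
    by (rule sum.cong[OF refl]) (simp only: mem_Collect_eq shift)
  \<comment> \<open>For fixed \<open>U\<close> the permutations
    \<open>tie_rank n U \<circ> \<sigma>\<close> run through all of \<open>?P\<close> as
    \<open>\<sigma>\<close> does.\<close>
  also have "\<dots> = (\<Sum>U\<in>?G. \<Sum>\<sigma>\<in>?P. F \<sigma>)"
    by (subst sum.swap, intro sum.cong refl setum_permutations_compose_left[symmetric] tie_rank_permutes)
  finally show ?thesis
    by (simp add: mean_def card_permutations[OF refl] field_simps)
qed

text \<open>For \<open>N \<ge> n\<close> the proportion is a product of the \<open>n\<close> factors
  \<open>(N - i) / N\<close>, each tending to 1.\<close>

lemma inj_grid_density:
  "(\<lambda>N. real (card {U \<in> {1..n} \<rightarrow>\<^sub>E {..<N}. inj_on U {1..n}}) / real N ^ n) \<longlonglongrightarrow> 1"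
proof -
  have "(\<lambda>N. \<Prod>i<n. (real N - real i) / real N) \<longlonglongrightarrow> (\<Prod>i<n. 1)"
  proof (intro tendsto_prod)
    fix i
    have "(\<lambda>N. 1 - real i / real N) \<longlonglongrightarrow> 1 - 0"
      by (intro tendsto_diff tendsto_const lim_const_over_n)
    moreover have "\<forall>\<^sub>F N in sequentially. 1 - real i / real N = (real N - real i) / real N"
      using eventually_gt_at_top[of 0] by eventually_elim (simp add: diff_divide_distrib)
    ultimately show "(\<lambda>N. (real N - real i) / real N) \<longlonglongrightarrow> 1"
      by (simp add: Lim_transform_eventually)
  qed
  moreover have "\<forall>\<^sub>F N in sequentially. (\<Prod>i<n. (real N - real i) / real N)
      = real (card {U \<in> {1..n} \<rightarrow>\<^sub>E {..<N}. inj_on U {1..n}}) / real N ^ n"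
    using eventually_ge_at_top[of n]
  proof eventually_elim
    case (elim N)
    have "card {U \<in> {1..n} \<rightarrow>\<^sub>E {..<N}. inj_on U {1..n}} = (\<Prod>i<n. N - i)"
      by (subst card_inj_on_subset_funcset) (auto simp: lessThan_atLeast0)
    moreover have "real (\<Prod>i<n. N - i) = (\<Prod>i<n. real N - real i)"
      using elim by (subst of_nat_prod, intro prod.cong) (auto simp: of_nat_diff)
    ultimately show ?case by (simp add: prod_dividef)
  qed
  ultimately show ?thesis by (simp add: Lim_transform_eventually)
qed

text \<open>An Efron--Stein type bound. Ranks of independent uniform points of a grid \<open>{..<N}\<close> (ties
  broken by the index) have bounded differences, and given that there are no ties, which has
  probability tending to 1, they form a uniformly random permutation.\<close>

lemma bounded_differences_permutations:
  fixes F :: "(nat \<Rightarrow> nat) \<Rightarrow> real" and n :: nat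
  defines "P \<equiv> {\<pi>. \<pi> permutes {1..n}}"
  assumes bd: "\<And>v \<pi> \<rho>. v \<in> {1..n} \<Longrightarrow> \<pi> \<in> P \<Longrightarrow> \<rho> \<in> P \<Longrightarrow>
      (\<And>i j. i \<in> {1..n} - {v} \<Longrightarrow> j \<in> {1..n} - {v} \<Longrightarrow> \<pi> i < \<pi> j \<longleftrightarrow> \<rho> i < \<rho> j) \<Longrightarrow>
      \<bar>F \<pi> - F \<rho>\<bar> \<le> c v"
  shows "mean P (\<lambda>\<pi>. (F \<pi> - mean P F)\<^sup>2) \<le> (\<Sum>v\<in>{1..n}. (c v)\<^sup>2) / 4"
proof -
  define V where "V = (\<Sum>v\<in>{1..n}. (c v)\<^sup>2) / 4"
  define p where "p N = real (card {U \<in> {1..n} \<rightarrow>\<^sub>E {..<N}. inj_on U {1..n}}) / real N ^ n" for N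
  have P: "finite P" "P \<noteq> {}"
    unfolding P_def by (auto simp: finite_permutations intro: permutes_id)
  \<comment> \<open>Dropping the grid points with ties from a sum of squares can only decrease it.
    The factor \<open>p N\<close>, the probability of no ties, disappears in the limit.\<close>
  have "p N * mean P (\<lambda>\<pi>. (F \<pi> - mean P F)\<^sup>2) \<le> V" if "N > 0" for N
  proof -
    let ?\<Omega> = "{1..n} \<rightarrow>\<^sub>E {..<N}"
    have "\<exists>m. mean ?\<Omega> (\<lambda>U. (F (tie_rank n U) - m)\<^sup>2) \<le> V"
      unfolding V_def
    proof (intro bounded_differences_PiE)
      fix v and U U' :: "nat \<Rightarrow> nat" assume v: "v \<in> {1..n}" and eq: "\<And>j. j \<noteq> v \<Longrightarrow> U j = U' j"
      show "\<bar>F (tie_rank n U) - F (tie_rank n U')\<bar> \<le> c v"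
      proof (rule bd[OF v])
        fix i j assume "i \<in> {1..n} - {v}" "j \<in> {1..n} - {v}"
        then show "tie_rank n U i < tie_rank n U j \<longleftrightarrow> tie_rank n U' i < tie_rank n U' j"
          using eq[of i] eq[of j] by (simp add: tie_rank_less_iff tie_less_def)
      qed (simp_all add: P_def tie_rank_permutes del: One_nat_def)
    qed (use that in auto)
    then obtain m where m: "mean ?\<Omega> (\<lambda>U. (F (tie_rank n U) - m)\<^sup>2) \<le> V" by blast
    have "p N * mean P (\<lambda>\<pi>. (F \<pi> - mean P F)\<^sup>2) \<le> p N * mean P (\<lambda>\<pi>. (F \<pi> - m)\<^sup>2)"
      using mean_square_shift[OF P, of F m] by (intro mult_left_mono) (auto simp: p_def)
    also have "\<dots> = (\<Sum>U\<in>{U \<in> ?\<Omega>. inj_on U {1..n}}. (F (tie_rank n U) - m)\<^sup>2) / real N ^ n"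
      using sum_tie_rank_inj[where n = n and N = N and F = "\<lambda>\<pi>. (F \<pi> - m)\<^sup>2"] by (simp add: p_def P_def)
    also have "\<dots> \<le> (\<Sum>U\<in>?\<Omega>. (F (tie_rank n U) - m)\<^sup>2) / real N ^ n"
      by (intro divide_right_mono sum_mono2) (auto intro: finite_PiE)
    also have "\<dots> = mean ?\<Omega> (\<lambda>U. (F (tie_rank n U) - m)\<^sup>2)"
      by (simp add: mean_def card_funcsetE)
    finally show ?thesis using m by simp
  qed
  then have ev: "\<forall>\<^sub>F N in sequentially. p N * mean P (\<lambda>\<pi>. (F \<pi> - mean P F)\<^sup>2) \<le> V"
    using eventually_gt_at_top[of 0] by (rule eventually_mono[rotated])
  have "(\<lambda>N. p N * mean P (\<lambda>\<pi>. (F \<pi> - mean P F)\<^sup>2)) \<longlonglongrightarrow> 1 * mean P (\<lambda>\<pi>. (F \<pi> - mean P F)\<^sup>2)"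
    unfolding p_def by (intro tendsto_mult tendsto_const inj_grid_density)
  from tendsto_upperbound[OF this ev] show ?thesis by (simp add: V_def)
qed

section \<open>Normal approximation by exchanges\<close>

lemma mean_abs_le_sqrt:
  assumes "finite A" "A \<noteq> {}"
  shows "mean A (\<lambda>x. \<bar>f x\<bar>) \<le> sqrt (mean A (\<lambda>x. (f x)\<^sup>2))"
proof (rule real_le_rsqrt)
  have "0 \<le> mean A (\<lambda>x. (\<bar>f x\<bar> - mean A (\<lambda>x. \<bar>f x\<bar>))\<^sup>2)"
    by (rule mean_nonneg) simp
  then show "(mean A (\<lambda>x. \<bar>f x\<bar>))\<^sup>2 \<le> mean A (\<lambda>x. (f x)\<^sup>2)"
    using mean_square_shift[OF assms, of "\<lambda>x. \<bar>f x\<bar>" 0] by simp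
qed

text \<open>Covariances with \<open>X\<close> are expressed through pairs of states exchanged by the involutions
  \<open>\<tau> q\<close>. Exchanging the two states turns the remainder of Stein's method, which is bounded by
  increments of a monotone function, into a covariance with a centred variable.\<close>

theorem stein_exchange_bound:
  fixes X :: "'a \<Rightarrow> real" and \<eta> :: "'q \<Rightarrow> 'a \<Rightarrow> real" and \<tau> :: "'q \<Rightarrow> 'a \<Rightarrow> 'a" and \<mu> \<sigma> z :: real
  assumes P: "finite P" "P \<noteq> {}"
    and inv: "\<And>q F. q \<in> Q \<Longrightarrow> mean P (\<lambda>x. F (\<tau> q x)) = mean P F"
    and invol: "\<And>q x. q \<in> Q \<Longrightarrow> x \<in> P \<Longrightarrow> \<tau> q (\<tau> q x) = x"
    and nonneg: "\<And>q x. q \<in> Q \<Longrightarrow> x \<in> P \<Longrightarrow> 0 \<le> \<eta> q x"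
    and \<sigma>: "0 < \<sigma>" and var: "\<sigma>\<^sup>2 = mean P (\<lambda>x. (X x - mean P X)\<^sup>2)"
    and cov: "\<And>F. mean P (\<lambda>x. (X x - \<mu>) * F x) = (\<Sum>q\<in>Q. mean P (\<lambda>x. \<eta> q x * (F x - F (\<tau> q x))))"
    and \<mu>: "\<mu> = mean P X"
  defines "D \<equiv> \<lambda>q x. X x - X (\<tau> q x)"
  defines "T \<equiv> \<lambda>x. \<Sum>q\<in>Q. \<eta> q x * D q x"
  defines "T' \<equiv> \<lambda>x. \<Sum>q\<in>Q. (\<eta> q x + \<eta> q (\<tau> q x)) * D q x"
  shows "\<bar>mean P (\<lambda>x. if (X x - \<mu>) / \<sigma> \<le> z then 1 else 0) - normal_cdf z\<bar>
    \<le> (sqrt (mean P (\<lambda>x. (T x - mean P T)\<^sup>2)) + sqrt (mean P (\<lambda>x. (T' x - mean P T')\<^sup>2)) / 2) / \<sigma>\<^sup>2"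
    and "mean P T = \<sigma>\<^sup>2"
proof -
  \<comment> \<open>The covariance formula with \<open>F = X\<close> identifies the mean of
    \<open>T\<close> with the variance.\<close>
  have "mean P T = mean P (\<lambda>x. (X x - \<mu>) * X x)"
    unfolding cov T_def D_def mean_sum ..
  also have "\<dots> = mean P (\<lambda>x. (X x - \<mu>)\<^sup>2 + \<mu> * (X x - \<mu>))"
    by (rule mean_cong) (simp add: power2_eq_square algebra_simps)
  also have "\<dots> = \<sigma>\<^sup>2"
    using P by (simp add: mean_add mean_cmult mean_diff mean_const var \<mu>)
  finally show T_mean: "mean P T = \<sigma>\<^sup>2" .

  define W where "W x = (X x - \<mu>) / \<sigma>" for x
  define g where "g w = w * stein_sol z w" for w
  define h where "h w = (if z < w then 1 else 0 :: real)" for w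
  let ?f = "stein_sol z" and ?p = "stein_deriv z"
  define r where "r q x = ?f (W x) - ?f (W (\<tau> q x)) - (W x - W (\<tau> q x)) * ?p (W x)" for q x
  define R where "R = (\<Sum>q\<in>Q. mean P (\<lambda>x. \<eta> q x * r q x))"
  have W_diff: "W x - W (\<tau> q x) = D q x / \<sigma>" for q x
    by (simp add: W_def D_def diff_divide_distrib)

  \<comment> \<open>Substituting \<open>\<tau> q x\<close> for \<open>x\<close> in the terms with
    \<open>k (\<tau> q x)\<close> flips the sign of \<open>D q\<close> and collects the weights
    \<open>\<eta> q x + \<eta> q (\<tau> q x)\<close>; hence the form of \<open>T'\<close>.\<close>
  have exch: "(\<Sum>q\<in>Q. mean P (\<lambda>x. \<eta> q x * (D q x * (k x - k (\<tau> q x))))) = mean P (\<lambda>x. k x * T' x)"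
    for k :: "'a \<Rightarrow> real"
  proof -
    have "mean P (\<lambda>x. \<eta> q x * (D q x * (k x - k (\<tau> q x))))
        = mean P (\<lambda>x. k x * ((\<eta> q x + \<eta> q (\<tau> q x)) * D q x))" if q: "q \<in> Q" for q
    proof -
      have "mean P (\<lambda>x. \<eta> q x * D q x * k (\<tau> q x))
          = mean P (\<lambda>x. \<eta> q (\<tau> q x) * D q (\<tau> q x) * k (\<tau> q (\<tau> q x)))"
        by (rule inv[OF q, symmetric])
      also have "\<dots> = mean P (\<lambda>x. - (k x * (\<eta> q (\<tau> q x) * D q x)))"
        by (rule mean_cong) (simp add: invol[OF q] D_def algebra_simps)
      finally have "mean P (\<lambda>x. \<eta> q x * D q x * k x) - mean P (\<lambda>x. \<eta> q x * D q x * k (\<tau> q x))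
          = mean P (\<lambda>x. \<eta> q x * D q x * k x) - mean P (\<lambda>x. - (k x * (\<eta> q (\<tau> q x) * D q x)))"
        by simp
      then show ?thesis
        unfolding mean_diff[symmetric] by (simp add: algebra_simps)
    qed
    then show ?thesis
      unfolding T'_def sum_distrib_left mean_sum by simp
  qed
  have T'_mean: "mean P T' = 0"
    using exch[of "\<lambda>_. 1"] by (simp add: mean_def)
  \<comment> \<open>Since \<open>T'\<close> has mean 0, \<open>k\<close> may be recentred to values
    between \<open>- 1 / 2\<close> and \<open>1 / 2\<close>; this is the source of the factor 1/2 in
    the bound.\<close>
  have cov_T': "\<bar>mean P (\<lambda>x. k x * T' x)\<bar> \<le> sqrt (mean P (\<lambda>x. (T' x)\<^sup>2)) / 2"
    if k: "\<And>x. l \<le> k x" "\<And>x. k x \<le> l + 1" for k :: "'a \<Rightarrow> real" and l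
  proof -
    have "mean P (\<lambda>x. k x * T' x) = mean P (\<lambda>x. (k x - (l + 1 / 2)) * T' x)"
      using T'_mean by (simp add: left_diff_distrib mean_diff mean_cmult)
    also have "\<bar>\<dots>\<bar> \<le> mean P (\<lambda>x. \<bar>(k x - (l + 1 / 2)) * T' x\<bar>)"
      by (rule abs_mean_le)
    also have "\<dots> \<le> mean P (\<lambda>x. (1 / 2) * \<bar>T' x\<bar>)"
    proof (rule mean_mono)
      fix x
      have "\<bar>k x - (l + 1 / 2)\<bar> \<le> 1 / 2" using k[of x] by linarith
      then show "\<bar>(k x - (l + 1 / 2)) * T' x\<bar> \<le> (1 / 2) * \<bar>T' x\<bar>"
        unfolding abs_mult by (rule mult_right_mono) simp
    qed
    also have "\<dots> \<le> (1 / 2) * sqrt (mean P (\<lambda>x. (T' x)\<^sup>2))"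
      unfolding mean_cmult using mean_abs_le_sqrt[OF P, of T'] by simp
    finally show ?thesis by simp
  qed

  \<comment> \<open>The remainder is squeezed between exchange sums of the monotone functions
    \<open>g\<close> and \<open>h\<close>, both of oscillation at most 1.\<close>
  have R_lower: "- (mean P (\<lambda>x. g (W x) * T' x) / \<sigma>) \<le> R"
  proof -
    have "(\<Sum>q\<in>Q. mean P (\<lambda>x. \<eta> q x * - (D q x / \<sigma> * (g (W x) - g (W (\<tau> q x)))))) \<le> R"
      unfolding R_def W_diff[symmetric] r_def g_def
      by (intro sum_mono mean_mono mult_left_mono nonneg stein_sol_increment(1))
    also have "(\<lambda>q x. \<eta> q x * - (D q x / \<sigma> * (g (W x) - g (W (\<tau> q x)))))
        = (\<lambda>q x. (- 1 / \<sigma>) * (\<eta> q x * (D q x * (g (W x) - g (W (\<tau> q x))))))"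
      by (simp add: fun_eq_iff)
    finally show ?thesis
      using exch[of "\<lambda>x. g (W x)"] unfolding mean_cmult sum_distrib_left[symmetric] by simp
  qed
  have R_upper: "R \<le> mean P (\<lambda>x. h (W x) * T' x) / \<sigma>"
  proof -
    have "R \<le> (\<Sum>q\<in>Q. mean P (\<lambda>x. \<eta> q x * (D q x / \<sigma> * (h (W x) - h (W (\<tau> q x))))))"
      unfolding R_def W_diff[symmetric] r_def h_def
      by (intro sum_mono mean_mono mult_left_mono nonneg stein_sol_increment(2))
    also have "(\<lambda>q x. \<eta> q x * (D q x / \<sigma> * (h (W x) - h (W (\<tau> q x)))))
        = (\<lambda>q x. (1 / \<sigma>) * (\<eta> q x * (D q x * (h (W x) - h (W (\<tau> q x))))))"
      by (simp add: fun_eq_iff)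
    finally show ?thesis
      using exch[of "\<lambda>x. h (W x)"] unfolding mean_cmult sum_distrib_left[symmetric] by simp
  qed
  have "\<bar>mean P (\<lambda>x. g (W x) * T' x)\<bar> \<le> sqrt (mean P (\<lambda>x. (T' x)\<^sup>2)) / 2"
    using times_stein_sol_bounds[where z = z]
    by (intro cov_T'[where l = "- (1 - normal_cdf z)"]) (auto simp: g_def)
  moreover have "\<bar>mean P (\<lambda>x. h (W x) * T' x)\<bar> \<le> sqrt (mean P (\<lambda>x. (T' x)\<^sup>2)) / 2"
    by (intro cov_T'[where l = 0]) (auto simp: h_def)
  ultimately have R: "\<bar>R\<bar> \<le> sqrt (mean P (\<lambda>x. (T' x)\<^sup>2)) / 2 / \<sigma>"
    using R_lower R_upper \<sigma>
      divide_right_mono[of "mean P (\<lambda>x. g (W x) * T' x)" "sqrt (mean P (\<lambda>x. (T' x)\<^sup>2)) / 2" \<sigma>]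
      divide_right_mono[of "mean P (\<lambda>x. h (W x) * T' x)" "sqrt (mean P (\<lambda>x. (T' x)\<^sup>2)) / 2" \<sigma>]
    by linarith

  have "mean P (\<lambda>x. W x * ?f (W x)) = mean P (\<lambda>x. (X x - \<mu>) * (?f (W x) / \<sigma>))"
    by (simp add: W_def)
  also have "\<dots> = (\<Sum>q\<in>Q. mean P (\<lambda>x. \<eta> q x * (?f (W x) / \<sigma> - ?f (W (\<tau> q x)) / \<sigma>)))"
    by (rule cov)
  \<comment> \<open>First-order expansion of \<open>?f\<close> at \<open>W x\<close> with remainder
    \<open>r\<close>; the increments of \<open>W\<close> are
    \<open>D q x / \<sigma>\<close>.\<close>
  also have "\<dots> = (\<Sum>q\<in>Q. mean P (\<lambda>x. (1 / \<sigma>\<^sup>2) * (?p (W x) * (\<eta> q x * D q x))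
      + (1 / \<sigma>) * (\<eta> q x * r q x)))"
  proof (intro sum.cong mean_cong refl)
    fix q x
    have "?f (W x) - ?f (W (\<tau> q x)) = D q x / \<sigma> * ?p (W x) + r q x"
      by (simp add: r_def W_diff)
    then have "\<eta> q x * (?f (W x) / \<sigma> - ?f (W (\<tau> q x)) / \<sigma>)
        = \<eta> q x * ((D q x / \<sigma> * ?p (W x) + r q x) / \<sigma>)"
      by (simp add: diff_divide_distrib[symmetric])
    then show "\<eta> q x * (?f (W x) / \<sigma> - ?f (W (\<tau> q x)) / \<sigma>) =
         (1 / \<sigma>\<^sup>2) * (?p (W x) * (\<eta> q x * D q x)) + (1 / \<sigma>) * (\<eta> q x * r q x)"
      using \<sigma> by (simp add: field_simps power2_eq_square)
  qed
  also have "\<dots> = (1 / \<sigma>\<^sup>2) * mean P (\<lambda>x. ?p (W x) * T x) + R / \<sigma>"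
    unfolding mean_add sum.distrib mean_cmult sum_distrib_left[symmetric] T_def R_def
    by (simp add: mean_sum sum_distrib_left sum_divide_distrib)
  finally have main: "mean P (\<lambda>x. W x * ?f (W x)) = mean P (\<lambda>x. ?p (W x) * T x) / \<sigma>\<^sup>2 + R / \<sigma>"
    by simp

  have "mean P (\<lambda>x. if W x \<le> z then 1 else 0) - normal_cdf z
      = mean P (\<lambda>x. (if W x \<le> z then 1 else 0) - normal_cdf z)"
    using P by (simp add: mean_diff mean_const)
  \<comment> \<open>Stein's equation at \<open>W x\<close>, averaged.\<close>
  also have "\<dots> = mean P (\<lambda>x. ?p (W x)) - mean P (\<lambda>x. W x * ?f (W x))"
    unfolding mean_diff[symmetric] by (simp add: stein_deriv_def)
  also have "\<dots> = mean P (\<lambda>x. ?p (W x) * (\<sigma>\<^sup>2 - T x)) / \<sigma>\<^sup>2 - R / \<sigma>"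
    using \<sigma> unfolding main right_diff_distrib mean_diff mult.commute[of _ "\<sigma>\<^sup>2"] mean_cmult
    by (simp add: field_simps)
  finally have eq: "mean P (\<lambda>x. if W x \<le> z then 1 else 0) - normal_cdf z
      = mean P (\<lambda>x. ?p (W x) * (\<sigma>\<^sup>2 - T x)) / \<sigma>\<^sup>2 - R / \<sigma>" .
  have "\<bar>mean P (\<lambda>x. ?p (W x) * (\<sigma>\<^sup>2 - T x))\<bar> \<le> mean P (\<lambda>x. \<bar>?p (W x) * (\<sigma>\<^sup>2 - T x)\<bar>)"
    by (rule abs_mean_le)
  also have "\<dots> \<le> mean P (\<lambda>x. \<bar>T x - \<sigma>\<^sup>2\<bar>)"
  proof (rule mean_mono)
    fix x
    show "\<bar>?p (W x) * (\<sigma>\<^sup>2 - T x)\<bar> \<le> \<bar>T x - \<sigma>\<^sup>2\<bar>"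
      unfolding abs_mult abs_minus_commute[of "\<sigma>\<^sup>2"]
      using mult_right_mono[OF stein_deriv_abs_le_1[of z "W x"], of "\<bar>T x - \<sigma>\<^sup>2\<bar>"] by simp
  qed
  also have "\<dots> \<le> sqrt (mean P (\<lambda>x. (T x - \<sigma>\<^sup>2)\<^sup>2))"
    by (rule mean_abs_le_sqrt[OF P])
  finally have "\<bar>mean P (\<lambda>x. ?p (W x) * (\<sigma>\<^sup>2 - T x)) / \<sigma>\<^sup>2\<bar> \<le> sqrt (mean P (\<lambda>x. (T x - \<sigma>\<^sup>2)\<^sup>2)) / \<sigma>\<^sup>2"
    by (simp add: divide_right_mono)
  moreover have "\<bar>R / \<sigma>\<bar> \<le> sqrt (mean P (\<lambda>x. (T' x)\<^sup>2)) / 2 / \<sigma>\<^sup>2"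
    using divide_right_mono[OF R, of \<sigma>] \<sigma> by (simp add: power2_eq_square)
  ultimately show "\<bar>mean P (\<lambda>x. if (X x - \<mu>) / \<sigma> \<le> z then 1 else 0) - normal_cdf z\<bar>
    \<le> (sqrt (mean P (\<lambda>x. (T x - mean P T)\<^sup>2)) + sqrt (mean P (\<lambda>x. (T' x - mean P T')\<^sup>2)) / 2) / \<sigma>\<^sup>2"
    using eq unfolding W_def add_divide_distrib T_mean T'_mean diff_0_right by linarith
qed

section \<open>Crossings of chords\<close>

lemma strictly_between_iff:
  "strictly_between i j k \<longleftrightarrow> (i < k \<and> k < j) \<or> (j < k \<and> k < i)"
  by (auto simp: strictly_between_def min_def max_def)

lemma strictly_between_commute: "strictly_between j i k = strictly_between i j k"
  by (auto simp: strictly_between_iff)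

lemma linorder_cases_4:
  fixes i j k l :: "'a :: linorder"
  assumes "distinct [i, j, k, l]"
  shows "i < j \<or> j < i" "i < k \<or> k < i" "i < l \<or> l < i" "j < k \<or> k < j" "j < l \<or> l < j" "k < l \<or> l < k"
  using assms by auto

lemma strictly_between_exchange:
  assumes "distinct [i, j, k, l]" "strictly_between i j k \<noteq> strictly_between i j l"
  shows "strictly_between k l i \<noteq> strictly_between k l j"
  using linorder_cases_4[OF assms(1)] assms(2) unfolding strictly_between_iff
  by (elim disjE; simp)

type_synonym quad = "nat \<times> nat \<times> nat \<times> nat"

fun verts :: "quad \<Rightarrow> nat set" where
  "verts (a, b, c, d) = {a, b, c, d}"

text \<open>A form of \<open>is_crossing\<close> with the end points named, as is needed to speak of
  exchanging \<open>b\<close> and \<open>c\<close>.\<close>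

fun chords_cross :: "(nat \<Rightarrow> nat) \<Rightarrow> quad \<Rightarrow> bool" where
  "chords_cross \<pi> (a, b, c, d) \<longleftrightarrow>
     strictly_between (\<pi> a) (\<pi> b) (\<pi> c) \<noteq> strictly_between (\<pi> a) (\<pi> b) (\<pi> d)"

definition cross_ind :: "(nat \<Rightarrow> nat) \<Rightarrow> quad \<Rightarrow> real" where
  "cross_ind \<pi> q = of_bool (chords_cross \<pi> q)"

text \<open>Exchanging the vertices \<open>b\<close> and \<open>c\<close> turns the pairing \<open>ac|bd\<close> of the four vertices into
  \<open>ab|cd\<close>; this is the coupling behind the covariance formula for the number of crossings.\<close>

fun mid_swap :: "quad \<Rightarrow> (nat \<Rightarrow> nat) \<Rightarrow> nat \<Rightarrow> nat" where
  "mid_swap (a, b, c, d) \<pi> = \<pi> \<circ> Transposition.transpose b c"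

text \<open>Crossings depend only on the relative order of positions. Two placements with the same
  order off a vertex \<open>w\<close> differ by moving \<open>w\<close>.\<close>

definition same_order :: "(nat \<Rightarrow> nat) \<Rightarrow> (nat \<Rightarrow> nat) \<Rightarrow> nat set \<Rightarrow> bool" where
  "same_order \<pi> \<rho> V \<longleftrightarrow> (\<forall>i\<in>V. \<forall>j\<in>V. \<pi> i < \<pi> j \<longleftrightarrow> \<rho> i < \<rho> j)"

lemma same_order_subset: "same_order \<pi> \<rho> V \<Longrightarrow> U \<subseteq> V \<Longrightarrow> same_order \<pi> \<rho> U"
  by (auto simp: same_order_def)

lemma cross_ind_cong: "same_order \<pi> \<rho> (verts q) \<Longrightarrow> cross_ind \<pi> q = cross_ind \<rho> q"
  by (cases q) (simp add: cross_ind_def strictly_between_iff same_order_def)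

lemma cross_ind_bounds: "0 \<le> cross_ind \<pi> q" "cross_ind \<pi> q \<le> 1"
  by (simp_all add: cross_ind_def)

text \<open>Among four points on a circle, only the pairing of opposite points has crossing
  chords.\<close>

lemma cross_ind_three_pairings:
  assumes "distinct [\<pi> a, \<pi> b, \<pi> c, \<pi> d]"
  shows "cross_ind \<pi> (a, b, c, d) + cross_ind \<pi> (a, c, b, d) + cross_ind \<pi> (a, d, b, c) = 1"
  using linorder_cases_4[OF assms] unfolding cross_ind_def chords_cross.simps strictly_between_iff
  by (elim disjE; simp)

lemma cross_ind_flip: "cross_ind \<pi> (a, b, d, c) = cross_ind \<pi> (a, b, c, d)"
  by (auto simp: cross_ind_def)

lemma cross_ind_mid_swap:
  assumes "a \<noteq> b" "a \<noteq> c" "d \<noteq> b" "d \<noteq> c"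
  shows "cross_ind (mid_swap (a, b, c, d) \<pi>) (a, b, c, d) = cross_ind \<pi> (a, c, b, d)"
  using assms by (simp add: cross_ind_def)

text \<open>The writing of the matching is immaterial: the order of end points by
  \<open>strictly_between_commute\<close>, the order of the chords by
  \<open>strictly_between_exchange\<close>.\<close>

lemma is_crossing_iff:
  assumes "distinct [\<pi> a, \<pi> b, \<pi> c, \<pi> d]"
  shows "is_crossing \<pi> {{a, b}, {c, d}} \<longleftrightarrow> chords_cross \<pi> (a, b, c, d)"
proof
  assume "is_crossing \<pi> {{a, b}, {c, d}}"
  then obtain a' b' c' d' where eq: "{{a, b}, {c, d}} = {{a', b'}, {c', d'}}"
    and cross: "chords_cross \<pi> (a', b', c', d')"
    unfolding is_crossing_def chords_cross.simps by blast
  from eq consider "{a', b'} = {a, b}" "{c', d'} = {c, d}" | "{a', b'} = {c, d}" "{c', d'} = {a, b}"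
    unfolding doubleton_eq_iff[of "{a, b}"] by metis
  then show "chords_cross \<pi> (a, b, c, d)"
  proof cases
    case 1
    with cross show ?thesis
      unfolding doubleton_eq_iff by (elim disjE conjE) (simp_all add: strictly_between_commute)
  next
    case 2
    with cross have "chords_cross \<pi> (c, d, a, b)"
      unfolding doubleton_eq_iff by (elim disjE conjE) (simp_all add: strictly_between_commute)
    then show ?thesis
      using strictly_between_exchange[of "\<pi> c" "\<pi> d" "\<pi> a" "\<pi> b"] assms by auto
  qed
next
  assume "chords_cross \<pi> (a, b, c, d)"
  then show "is_crossing \<pi> {{a, b}, {c, d}}"
    unfolding is_crossing_def chords_cross.simps by blast
qed

lemma cross_ind_mid_swap_disjoint:
  assumes "b \<notin> verts q" "c \<notin> verts q"
  shows "cross_ind (mid_swap (a, b, c, d) \<pi>) q = cross_ind \<pi> q"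
  using assms by (cases q) (simp add: cross_ind_def)

lemma same_order_mid_swap:
  assumes "same_order \<pi> \<rho> (V - {w})" "b \<in> V - {w}" "c \<in> V - {w}"
  shows "same_order (mid_swap (a, b, c, d) \<pi>) (mid_swap (a, b, c, d) \<rho>) (V - {w})"
proof -
  have "Transposition.transpose b c i \<in> V - {w}" if "i \<in> V - {w}" for i
    using assms that by (cases "i = b"; cases "i = c") simp_all
  then show ?thesis
    using assms(1) unfolding same_order_def mid_swap.simps comp_def by blast
qed

section \<open>Counting pairs of disjoint edges\<close>

lemma card_UN_le_mult:
  assumes "finite I" "\<And>i. i \<in> I \<Longrightarrow> card (S i) \<le> k"
  shows "card (\<Union>i\<in>I. S i) \<le> card I * k"
  using card_UN_le[OF assms(1), of S] sum_bounded_above[of I "\<lambda>i. card (S i)" k] assms(2)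
  by fastforce

lemma card_doubleton_le: "card {a, b} \<le> 2"
  by (cases "a = b") auto

lemma sum_of_bool_card:
  "finite A \<Longrightarrow> (\<Sum>x\<in>A. k * of_bool (R x)) = k * real (card {x \<in> A. R x})" for k :: real
  by (simp add: sum_distrib_left[symmetric] of_bool_def sum.If_cases Collect_conj_eq)

locale bounded_degree_graph =
  fixes n :: nat and E :: "nat set set" and m \<Delta> :: nat
  assumes simple: "simple_graph n E"
    and card_E: "card E = m"
    and degree_le: "\<And>v. v \<in> {1..n} \<Longrightarrow> degree E v \<le> \<Delta>"
begin

lemma edgeD: "{a, b} \<in> E \<Longrightarrow> a \<noteq> b \<and> a \<in> {1..n} \<and> b \<in> {1..n}"
  using simple by (fastforce simp: simple_graph_def)

lemma edgeE:
  assumes "e \<in> E"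
  obtains a b where "e = {a, b}" "a \<noteq> b" "a \<in> {1..n}" "b \<in> {1..n}"
  using assms simple by (auto simp: simple_graph_def card_2_iff)

lemma finite_E: "finite E"
  by (rule finite_subset[of _ "Pow {1..n}"]) (use simple in \<open>auto simp: simple_graph_def\<close>)

definition nbrs :: "nat \<Rightarrow> nat set" where
  "nbrs v = {w. {v, w} \<in> E}"

definition darts :: "(nat \<times> nat) set" where
  "darts = {(a, b). {a, b} \<in> E}"

text \<open>Ordered form of the 2-matchings. Each is represented by 8 quadruples, from two
  orientations of each edge and two orders of the edges.\<close>

definition quads :: "quad set" where
  "quads = {(a, b, c, d). {a, b} \<in> E \<and> {c, d} \<in> E \<and> {a, b} \<inter> {c, d} = {}}"

lemma finite_nbrs: "finite (nbrs v)"
  by (rule finite_subset[of _ "{1..n}"]) (auto simp: nbrs_def dest: edgeD)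

lemma finite_darts: "finite darts"
  by (rule finite_subset[of _ "{1..n} \<times> {1..n}"]) (auto simp: darts_def dest: edgeD)

lemma finite_quads: "finite quads"
  by (rule finite_subset[of _ "{1..n} \<times> {1..n} \<times> {1..n} \<times> {1..n}"])
    (auto simp: quads_def dest: edgeD)

lemma card_nbrs: "card (nbrs v) = degree E v"
proof -
  have "bij_betw (\<lambda>w. {v, w}) (nbrs v) {e \<in> E. v \<in> e}"
  proof (rule bij_betw_imageI)
    show "inj_on (\<lambda>w. {v, w}) (nbrs v)"
      by (auto simp: inj_on_def doubleton_eq_iff)
    show "(\<lambda>w. {v, w}) ` nbrs v = {e \<in> E. v \<in> e}"
    proof (intro equalityI subsetI)
      fix e assume "e \<in> {e \<in> E. v \<in> e}"
      then have e: "e \<in> E" "v \<in> e" by auto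
      from edgeE[OF e(1)] obtain a b where "e = {a, b}" .
      then have "e = {v, a} \<or> e = {v, b}" using e(2) by auto
      then show "e \<in> (\<lambda>w. {v, w}) ` nbrs v" using e(1) by (auto simp: nbrs_def)
    qed (auto simp: nbrs_def)
  qed
  then show ?thesis by (simp add: degree_def bij_betw_same_card)
qed

lemma card_nbrs_le: "v \<in> {1..n} \<Longrightarrow> card (nbrs v) \<le> \<Delta>"
  using degree_le by (simp add: card_nbrs)

lemma card_darts: "card darts = 2 * m"
proof -
  have "card darts = (\<Sum>e\<in>E. card {p \<in> darts. {fst p, snd p} = e})"
    using sum.group[OF finite_darts finite_E, of "\<lambda>p. {fst p, snd p}" "\<lambda>_. 1::nat"]
    by (auto simp: darts_def image_subset_iff)
  also have "\<dots> = (\<Sum>e\<in>E. 2)"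
  proof (rule sum.cong[OF refl])
    fix e assume e: "e \<in> E"
    then obtain a b where ab: "e = {a, b}" "a \<noteq> b" by (rule edgeE)
    with e have "{p \<in> darts. {fst p, snd p} = e} = {(a, b), (b, a)}"
      by (auto simp: darts_def doubleton_eq_iff insert_commute)
    with ab show "card {p \<in> darts. {fst p, snd p} = e} = 2" by simp
  qed
  finally show ?thesis by (simp add: card_E)
qed

lemma darts_Sigma: "darts = (SIGMA v:{1..n}. nbrs v)"
  by (auto simp: darts_def nbrs_def dest: edgeD)

lemma sum_degree: "(\<Sum>v\<in>{1..n}. degree E v) = 2 * m"
  using card_darts unfolding darts_Sigma by (simp add: card_nbrs finite_nbrs)

lemma sum_degree_square_le: "(\<Sum>v\<in>{1..n}. (real (degree E v))\<^sup>2) \<le> 2 * real m * real \<Delta>"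
proof -
  have "(\<Sum>v\<in>{1..n}. (real (degree E v))\<^sup>2) \<le> (\<Sum>v\<in>{1..n}. real (degree E v) * real \<Delta>)"
    using degree_le by (intro sum_mono) (auto simp: power2_eq_square intro!: mult_left_mono)
  also have "\<dots> = real (\<Sum>v\<in>{1..n}. degree E v) * real \<Delta>"
    by (simp add: sum_distrib_right)
  finally show ?thesis by (simp only: sum_degree)
qed

lemma quadsD:
  assumes "(a, b, c, d) \<in> quads"
  shows "distinct [a, b, c, d]" "{a, b, c, d} \<subseteq> {1..n}"
  using assms edgeD[of a b] edgeD[of c d] by (auto simp: quads_def)

lemma sum_quads: "(\<Sum>(a, b, c, d)\<in>quads. f {{a, b}, {c, d}}) = 8 * (\<Sum>M\<in>matchings 2 E. f M)"
  for f :: "nat set set \<Rightarrow> real"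
proof -
  define \<Phi> :: "quad \<Rightarrow> nat set set" where "\<Phi> = (\<lambda>(a, b, c, d). {{a, b}, {c, d}})"
  have fin: "finite (matchings 2 E)"
    by (rule finite_subset[of _ "Pow E"]) (auto simp: matchings_def finite_E)
  have img: "\<Phi> ` quads \<subseteq> matchings 2 E"
    by (auto simp: \<Phi>_def matchings_def quads_def card_2_iff doubleton_eq_iff pairwise_insert disjnt_def)
  have fib: "card {q \<in> quads. \<Phi> q = M} = 8" if M: "M \<in> matchings 2 E" for M
  proof -
    have "card M = 2" using M by (simp add: matchings_def)
    then obtain e e' where e: "M = {e, e'}" "e \<noteq> e'" unfolding card_2_iff by blast
    have e_E: "e \<in> E" "e' \<in> E" and disj: "disjnt e e'"
      using M e by (auto simp: matchings_def pairwise_def)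
    obtain a b where ab: "e = {a, b}" "a \<noteq> b" using edgeE[OF e_E(1)] by metis
    obtain c d where cd: "e' = {c, d}" "c \<noteq> d" using edgeE[OF e_E(2)] by metis
    have dist: "distinct [a, b, c, d]" using ab cd disj by (auto simp: disjnt_def)
    have "{q \<in> quads. \<Phi> q = M} = set [(a, b, c, d), (b, a, c, d), (a, b, d, c), (b, a, d, c),
        (c, d, a, b), (c, d, b, a), (d, c, a, b), (d, c, b, a)]"
    proof (intro equalityI subsetI)
      fix q assume "q \<in> {q \<in> quads. \<Phi> q = M}"
      moreover obtain a' b' c' d' where q: "q = (a', b', c', d')" by (cases q)
      ultimately have "{{a', b'}, {c', d'}} = {{a, b}, {c, d}}"
        by (simp add: \<Phi>_def e ab cd)
      then show "q \<in> set [(a, b, c, d), (b, a, c, d), (a, b, d, c), (b, a, d, c),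
        (c, d, a, b), (c, d, b, a), (d, c, a, b), (d, c, b, a)]"
        unfolding q doubleton_eq_iff by (elim disjE conjE) simp_all
    qed (use e e_E ab cd dist in \<open>auto simp: \<Phi>_def quads_def insert_commute\<close>)
    moreover have "distinct [(a, b, c, d), (b, a, c, d), (a, b, d, c), (b, a, d, c),
        (c, d, a, b), (c, d, b, a), (d, c, a, b), (d, c, b, a)]"
      using dist by auto
    ultimately show ?thesis by (simp only: distinct_card) simp
  qed
  have "(\<Sum>q\<in>quads. f (\<Phi> q)) = (\<Sum>M\<in>matchings 2 E. \<Sum>q\<in>{q \<in> quads. \<Phi> q = M}. f (\<Phi> q))"
    by (rule sum.group[OF finite_quads fin img, symmetric])
  also have "\<dots> = (\<Sum>M\<in>matchings 2 E. 8 * f M)"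
    by (intro sum.cong refl) (simp add: fib)
  finally show ?thesis
    by (simp add: \<Phi>_def sum_distrib_left case_prod_unfold)
qed

lemma card_quads: "real (card quads) = 8 * real (num_matchings 2 E)"
  using sum_quads[of "\<lambda>_. 1"] by (simp add: num_matchings_def case_prod_unfold)

lemma crossings_eq_sum:
  assumes "\<pi> permutes {1..n}"
  shows "crossings E \<pi> = (\<Sum>q\<in>quads. cross_ind \<pi> q) / 8"
proof -
  have "(\<Sum>q\<in>quads. cross_ind \<pi> q) = (\<Sum>(a, b, c, d)\<in>quads. of_bool (is_crossing \<pi> {{a, b}, {c, d}}))"
  proof (intro sum.cong refl)
    fix q assume q: "q \<in> quads"
    obtain a b c d where [simp]: "q = (a, b, c, d)" by (cases q)
    have "distinct [\<pi> a, \<pi> b, \<pi> c, \<pi> d]"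
      using quadsD(1)[of a b c d] q by (simp add: inj_eq[OF permutes_inj[OF assms]])
    then show "cross_ind \<pi> q = (case q of (a, b, c, d) \<Rightarrow> of_bool (is_crossing \<pi> {{a, b}, {c, d}}))"
      by (simp add: cross_ind_def is_crossing_iff del: chords_cross.simps)
  qed
  also have "\<dots> = 8 * (\<Sum>M\<in>matchings 2 E. of_bool (is_crossing \<pi> M))"
    by (rule sum_quads)
  also have "(\<Sum>M\<in>matchings 2 E. of_bool (is_crossing \<pi> M)) = crossings E \<pi>"
  proof -
    have "finite (matchings 2 E)"
      by (rule finite_subset[of _ "Pow E"]) (auto simp: matchings_def finite_E)
    then show ?thesis
      by (simp add: crossings_def of_bool_def sum.If_cases Collect_conj_eq)
  qed
  finally show ?thesis by simp
qed

section \<open>Bounds for numbers of quadruples\<close>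

lemma card_quads_le: "card quads \<le> 4 * m\<^sup>2"
proof -
  have "card quads = card ((\<lambda>(a, b, c, d). ((a, b), (c, d))) ` quads)"
    by (rule card_image[symmetric]) (auto simp: inj_on_def)
  also have "\<dots> \<le> card (darts \<times> darts)"
    by (rule card_mono[OF finite_cartesian_product[OF finite_darts finite_darts]])
      (auto simp: quads_def darts_def)
  finally show ?thesis by (simp add: card_cartesian_product card_darts power2_eq_square)
qed

text \<open>Two darts that do not form a quadruple share a vertex. For a given dart there are two
  end points, at most \<open>\<Delta>\<close> neighbours and two orientations, so at most
  \<open>4 * \<Delta>\<close> such partners; there are \<open>2 * m\<close> darts.\<close>

lemma card_quads_ge: "4 * m\<^sup>2 \<le> card quads + 8 * m * \<Delta>"
proof -
  let ?S = "\<lambda>p. \<Union>x\<in>{fst p, snd p}. \<Union>y\<in>nbrs x. {(p, (x, y)), (p, (y, x))}"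
  have card_S: "card (?S p) \<le> 4 * \<Delta>" if p: "p \<in> darts" for p
  proof -
    have inner: "card (\<Union>y\<in>nbrs x. {(p, (x, y)), (p, (y, x))}) \<le> 2 * \<Delta>" if "x \<in> {fst p, snd p}" for x
    proof -
      have "card (\<Union>y\<in>nbrs x. {(p, (x, y)), (p, (y, x))}) \<le> card (nbrs x) * 2"
        by (rule card_UN_le_mult[OF finite_nbrs card_doubleton_le])
      moreover have "card (nbrs x) \<le> \<Delta>"
        using p that edgeD by (intro card_nbrs_le) (auto simp: darts_def)
      ultimately show ?thesis by linarith
    qed
    have "card (?S p) \<le> card {fst p, snd p} * (2 * \<Delta>)"
      by (rule card_UN_le_mult[OF _ inner]) simp_all
    moreover have "card {fst p, snd p} * (2 * \<Delta>) \<le> 2 * (2 * \<Delta>)"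
      by (rule mult_right_mono[OF card_doubleton_le]) simp
    ultimately show ?thesis by linarith
  qed
  have "darts \<times> darts \<subseteq> (\<lambda>(a, b, c, d). ((a, b), (c, d))) ` quads \<union> (\<Union>p\<in>darts. ?S p)"
  proof
    fix t assume t: "t \<in> darts \<times> darts"
    obtain a b c d where [simp]: "t = ((a, b), (c, d))" by (metis surj_pair)
    show "t \<in> (\<lambda>(a, b, c, d). ((a, b), (c, d))) ` quads \<union> (\<Union>p\<in>darts. ?S p)"
    proof (cases "(a, b, c, d) \<in> quads")
      case True
      then show ?thesis by (force simp: image_iff)
    next
      case False
      then have "c \<in> {a, b} \<or> d \<in> {a, b}" using t by (auto simp: quads_def darts_def)
      then have in_S: "t \<in> ?S (a, b)"
        using t by (auto simp: darts_def nbrs_def insert_commute)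
      have "(a, b) \<in> darts" using t by simp
      from UN_I[of "(a, b)" darts t ?S, OF this in_S] show ?thesis by (rule UnI2)
    qed
  qed
  then have "card (darts \<times> darts)
      \<le> card ((\<lambda>(a, b, c, d). ((a, b), (c, d))) ` quads \<union> (\<Union>p\<in>darts. ?S p))"
    by (rule card_mono[rotated]) (auto simp: finite_quads finite_darts finite_nbrs)
  also have "\<dots> \<le> card quads + card darts * (4 * \<Delta>)"
    by (rule order_trans[OF card_Un_le add_mono[OF card_image_le[OF finite_quads]
          card_UN_le_mult[OF finite_darts card_S]]])
  finally show ?thesis by (simp add: card_cartesian_product card_darts power2_eq_square)
qed

text \<open>Four places for \<open>w\<close>, a partner on its edge, and one of \<open>2 * m\<close>
  darts for the other edge.\<close>

lemma card_quads_containing: "card {q \<in> quads. w \<in> verts q} \<le> 8 * m * degree E w"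
proof -
  let ?S = "\<lambda>(x, c, d). set [(w, x, c, d), (x, w, c, d), (c, d, w, x), (c, d, x, w)]"
  have "{q \<in> quads. w \<in> verts q} \<subseteq> (\<Union>p\<in>nbrs w \<times> darts. ?S p)"
  proof
    fix q assume q: "q \<in> {q \<in> quads. w \<in> verts q}"
    obtain a b c d where [simp]: "q = (a, b, c, d)" by (cases q)
    have E: "{a, b} \<in> E" "{b, a} \<in> E" "{c, d} \<in> E" "{d, c} \<in> E" and w: "w \<in> {a, b, c, d}"
      using q by (auto simp: quads_def insert_commute)
    then have "q \<in> ?S (b, c, d) \<and> (b, c, d) \<in> nbrs w \<times> darts \<or> q \<in> ?S (a, c, d) \<and> (a, c, d) \<in> nbrs w \<times> darts
      \<or> q \<in> ?S (d, a, b) \<and> (d, a, b) \<in> nbrs w \<times> darts \<or> q \<in> ?S (c, a, b) \<and> (c, a, b) \<in> nbrs w \<times> darts"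
      by (auto simp: nbrs_def darts_def)
    then show "q \<in> (\<Union>p\<in>nbrs w \<times> darts. ?S p)" by blast
  qed
  then have "card {q \<in> quads. w \<in> verts q} \<le> card (\<Union>p\<in>nbrs w \<times> darts. ?S p)"
    by (rule card_mono[rotated]) (auto simp: finite_nbrs finite_darts)
  also have "\<dots> \<le> card (nbrs w \<times> darts) * 4"
  proof (rule card_UN_le_mult[OF finite_cartesian_product[OF finite_nbrs finite_darts]])
    fix p :: "nat \<times> nat \<times> nat"
    show "card (?S p) \<le> 4"
      by (cases p) (auto intro: order_trans[OF card_length] simp del: list.set)
  qed
  finally show ?thesis by (simp add: card_cartesian_product card_darts card_nbrs mult_ac)
qed

text \<open>Either the vertices lie on different edges, with 8 placements and a partner for each, or
  they form an edge, with 4 placements and a dart for the other edge.\<close>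

lemma card_quads_containing_two:
  assumes "w \<noteq> u"
  shows "card {q \<in> quads. w \<in> verts q \<and> u \<in> verts q}
    \<le> 8 * degree E w * degree E u + 8 * m * of_bool (u \<in> nbrs w)"
proof -
  define S where "S = (\<lambda>(x, y). set [(w, x, u, y), (w, x, y, u), (x, w, u, y), (x, w, y, u),
    (u, y, w, x), (y, u, w, x), (u, y, x, w), (y, u, x, w)])"
  define S' where "S' = (\<lambda>(c, d). set [(w, u, c, d), (u, w, c, d), (c, d, w, u), (c, d, u, w)])"
  let ?A = "\<Union>p\<in>nbrs w \<times> nbrs u. S p" and ?B = "\<Union>p\<in>(if u \<in> nbrs w then darts else {}). S' p"
  have fin: "finite (S p)" "finite (S' p)" for p
    by (cases p; simp add: S_def S'_def)+
  have card_S: "card (S p) \<le> 8" for p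
    by (cases p) (auto simp: S_def intro: order_trans[OF card_length] simp del: list.set)
  have card_S': "card (S' p) \<le> 4" for p
    by (cases p) (auto simp: S'_def intro: order_trans[OF card_length] simp del: list.set)
  have "{q \<in> quads. w \<in> verts q \<and> u \<in> verts q} \<subseteq> ?A \<union> ?B"
  proof
    fix q assume q: "q \<in> {q \<in> quads. w \<in> verts q \<and> u \<in> verts q}"
    obtain a b c d where abcd: "q = (a, b, c, d)" by (cases q)
    have E: "{a, b} \<in> E" "{b, a} \<in> E" "{c, d} \<in> E" "{d, c} \<in> E"
      and w: "w \<in> {a, b, c, d}" and u: "u \<in> {a, b, c, d}"
      using q by (auto simp: abcd quads_def insert_commute)
    have mem: "q \<in> ?A \<union> ?B" if "q \<in> S (x, y)" "{w, x} \<in> E" "{u, y} \<in> E" for x y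
      using that unfolding nbrs_def by blast
    consider "{w, u} = {a, b}" | "{w, u} = {c, d}"
      | "w \<in> {a, b}" "u \<in> {c, d}" | "w \<in> {c, d}" "u \<in> {a, b}"
      using w u assms by auto
    then show "q \<in> ?A \<union> ?B"
    proof cases
      case 1
      then have "u \<in> nbrs w" "(c, d) \<in> darts" using E by (auto simp: nbrs_def darts_def)
      moreover have "q \<in> S' (c, d)"
        using 1 unfolding abcd S'_def doubleton_eq_iff by auto
      ultimately have "q \<in> ?B" by (simp only: if_True) blast
      then show ?thesis by blast
    next
      case 2
      then have "u \<in> nbrs w" "(a, b) \<in> darts" using E by (auto simp: nbrs_def darts_def)
      moreover have "q \<in> S' (a, b)"
        using 2 unfolding abcd S'_def doubleton_eq_iff by auto
      ultimately have "q \<in> ?B" by (simp only: if_True) blast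
      then show ?thesis by blast
    next
      case 3
      then consider "w = a" "u = c" | "w = a" "u = d"
        | "w = b" "u = c" | "w = b" "u = d"
        by auto
      then show ?thesis
      proof cases
        case 1
        then show ?thesis by (intro mem[of b d]) (use E in \<open>simp_all add: S_def abcd\<close>)
      next
        case 2
        then show ?thesis by (intro mem[of b c]) (use E in \<open>simp_all add: S_def abcd\<close>)
      next
        case 3
        then show ?thesis by (intro mem[of a d]) (use E in \<open>simp_all add: S_def abcd\<close>)
      next
        case 4
        then show ?thesis by (intro mem[of a c]) (use E in \<open>simp_all add: S_def abcd\<close>)
      qed
    next
      case 4
      then consider "w = c" "u = a" | "w = c" "u = b"
        | "w = d" "u = a" | "w = d" "u = b"
        by auto
      then show ?thesis
      proof cases
        case 1
        then show ?thesis by (intro mem[of d b]) (use E in \<open>simp_all add: S_def abcd\<close>)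
      next
        case 2
        then show ?thesis by (intro mem[of d a]) (use E in \<open>simp_all add: S_def abcd\<close>)
      next
        case 3
        then show ?thesis by (intro mem[of c b]) (use E in \<open>simp_all add: S_def abcd\<close>)
      next
        case 4
        then show ?thesis by (intro mem[of c a]) (use E in \<open>simp_all add: S_def abcd\<close>)
      qed
    qed
  qed
  then have "card {q \<in> quads. w \<in> verts q \<and> u \<in> verts q} \<le> card (?A \<union> ?B)"
    by (rule card_mono[rotated]) (auto simp: finite_nbrs finite_darts fin)
  also have "\<dots> \<le> card (nbrs w \<times> nbrs u) * 8 + card (if u \<in> nbrs w then darts else {}) * 4"
    by (rule order_trans[OF card_Un_le add_mono[OF card_UN_le_mult card_UN_le_mult]])
      (simp_all add: finite_nbrs finite_darts card_S card_S')
  also have "card (if u \<in> nbrs w then darts else {}) * 4 = 8 * m * of_bool (u \<in> nbrs w)"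
    by (simp add: card_darts)
  finally show ?thesis by (simp add: card_cartesian_product card_nbrs mult_ac)
qed

text \<open>Choose the neighbour of \<open>w\<close>, then its partner on its own edge, then a dart
  for the other edge.\<close>

lemma card_quads_mid_adjacent:
  "card {(a, b, c, d) \<in> quads. b \<in> nbrs w} \<le> 2 * m * \<Delta> * degree E w"
  "card {(a, b, c, d) \<in> quads. c \<in> nbrs w} \<le> 2 * m * \<Delta> * degree E w"
proof -
  have S: "card (SIGMA y:nbrs w. nbrs y \<times> darts) \<le> 2 * m * \<Delta> * degree E w"
  proof -
    have "card (SIGMA y:nbrs w. nbrs y \<times> darts) = (\<Sum>y\<in>nbrs w. card (nbrs y) * (2 * m))"
      by (simp add: card_SigmaI finite_nbrs finite_darts card_cartesian_product card_darts)
    also have "\<dots> \<le> (\<Sum>y\<in>nbrs w. \<Delta> * (2 * m))"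
      by (intro sum_mono mult_right_mono card_nbrs_le) (auto simp: nbrs_def dest: edgeD)
    finally show ?thesis by (simp add: card_nbrs mult_ac)
  qed
  have fin: "finite (SIGMA y:nbrs w. nbrs y \<times> darts)"
    by (simp add: finite_nbrs finite_darts)
  have "card {(a, b, c, d) \<in> quads. b \<in> nbrs w} \<le> card (SIGMA y:nbrs w. nbrs y \<times> darts)"
    by (rule card_inj_on_le[of "\<lambda>(a, b, c, d). (b, a, c, d)", OF _ _ fin])
      (auto simp: inj_on_def quads_def nbrs_def darts_def insert_commute)
  with S show "card {(a, b, c, d) \<in> quads. b \<in> nbrs w} \<le> 2 * m * \<Delta> * degree E w" by simp
  have "card {(a, b, c, d) \<in> quads. c \<in> nbrs w} \<le> card (SIGMA y:nbrs w. nbrs y \<times> darts)"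
    by (rule card_inj_on_le[of "\<lambda>(a, b, c, d). (c, d, a, b)", OF _ _ fin])
      (auto simp: inj_on_def quads_def nbrs_def darts_def insert_commute)
  with S show "card {(a, b, c, d) \<in> quads. c \<in> nbrs w} \<le> 2 * m * \<Delta> * degree E w" by simp
qed

section \<open>Normal approximation of the number of crossings\<close>

definition perms :: "(nat \<Rightarrow> nat) set" where
  "perms = {\<pi>. \<pi> permutes {1..n}}"

lemma perms_finite_nonempty: "finite perms" "perms \<noteq> {}"
  by (auto simp: perms_def finite_permutations intro: permutes_id)

lemma mid_swap_perms:
  assumes "q \<in> quads" "\<pi> \<in> perms"
  shows "mid_swap q \<pi> \<in> perms"
proof -
  obtain a b c d where q: "q = (a, b, c, d)" by (cases q)
  have "Transposition.transpose b c permutes {1..n}"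
    using quadsD(2)[of a b c d] assms(1) by (intro permutes_swap_id) (auto simp: q)
  with assms(2) show ?thesis unfolding perms_def q mid_swap.simps by (simp only: mem_Collect_eq permutes_compose)
qed

lemma mean_mid_swap:
  assumes "q \<in> quads"
  shows "mean perms (\<lambda>\<pi>. F (mid_swap q \<pi>)) = mean perms F"
proof -
  obtain a b c d where q: "q = (a, b, c, d)" by (cases q)
  have "Transposition.transpose b c permutes {1..n}"
    using quadsD(2)[of a b c d] assms(1) by (intro permutes_swap_id) (auto simp: q)
  from sum_permutations_compose_right[OF this, of F] show ?thesis
    unfolding mean_def q mid_swap.simps perms_def by simp
qed

lemma mid_swap_mid_swap: "mid_swap q (mid_swap q \<pi>) = \<pi>"
  by (cases q) (simp add: comp_assoc)

section \<open>The covariance formula\<close>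

lemma quads_flip: "(a, b, c, d) \<in> quads \<Longrightarrow> (a, b, d, c) \<in> quads"
  by (auto simp: quads_def insert_commute)

lemma distinct_positions:
  assumes "(a, b, c, d) \<in> quads" "\<pi> \<in> perms"
  shows "distinct [\<pi> a, \<pi> b, \<pi> c, \<pi> d]"
  using quadsD(1)[OF assms(1)] assms(2) by (auto simp: perms_def inj_eq[OF permutes_inj])

text \<open>The pairing \<open>ad|bc\<close> is reached by the same swap after flipping
  \<open>c\<close> and \<open>d\<close>, so \<open>mid_swap\<close> expresses both other
  pairings.\<close>

lemma cross_ind_three:
  assumes q: "(a, b, c, d) \<in> quads" and \<pi>: "\<pi> \<in> perms"
  shows "cross_ind \<pi> (a, b, c, d) + cross_ind (mid_swap (a, b, c, d) \<pi>) (a, b, c, d)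
    + cross_ind (mid_swap (a, b, d, c) \<pi>) (a, b, d, c) = 1"
proof -
  have "cross_ind (mid_swap (a, b, c, d) \<pi>) (a, b, c, d) = cross_ind \<pi> (a, c, b, d)"
    using quadsD(1)[OF q] by (intro cross_ind_mid_swap) auto
  moreover have "cross_ind (mid_swap (a, b, d, c) \<pi>) (a, b, d, c) = cross_ind \<pi> (a, d, b, c)"
    using quadsD(1)[OF q] by (intro cross_ind_mid_swap) auto
  ultimately show ?thesis
    using cross_ind_three_pairings[where \<pi> = \<pi>, OF distinct_positions[OF q \<pi>]] by simp
qed

lemma mean_cross_ind_swap:
  assumes "q \<in> quads"
  shows "mean perms (\<lambda>\<pi>. cross_ind (mid_swap q \<pi>) q * F \<pi>) = mean perms (\<lambda>\<pi>. cross_ind \<pi> q * F (mid_swap q \<pi>))"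
  using mean_mid_swap[OF assms, of "\<lambda>\<pi>. cross_ind \<pi> q * F (mid_swap q \<pi>)"]
  by (simp add: mid_swap_mid_swap)

text \<open>\<open>F\<close> is split according to which pairing crosses; each swap is then moved
  from the indicator onto \<open>F\<close>, as it preserves the uniform distribution.\<close>

lemma mean_cross_ind_three:
  fixes F :: "(nat \<Rightarrow> nat) \<Rightarrow> real"
  assumes q: "(a, b, c, d) \<in> quads"
  defines "gap \<equiv> \<lambda>q. mean perms (\<lambda>\<pi>. cross_ind \<pi> q * (F \<pi> - F (mid_swap q \<pi>)))"
  shows "3 * mean perms (\<lambda>\<pi>. cross_ind \<pi> (a, b, c, d) * F \<pi>)
    = mean perms F + gap (a, b, c, d) + gap (a, b, d, c)"
proof -
  let ?A = "mean perms (\<lambda>\<pi>. cross_ind \<pi> (a, b, c, d) * F \<pi>)"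
  let ?B = "\<lambda>q. mean perms (\<lambda>\<pi>. cross_ind \<pi> q * F (mid_swap q \<pi>))"
  have "mean perms F = mean perms (\<lambda>\<pi>. cross_ind \<pi> (a, b, c, d) * F \<pi>
      + (cross_ind (mid_swap (a, b, c, d) \<pi>) (a, b, c, d) * F \<pi>
      + cross_ind (mid_swap (a, b, d, c) \<pi>) (a, b, d, c) * F \<pi>))"
  proof (rule mean_cong)
    fix \<pi> assume "\<pi> \<in> perms"
    have "F \<pi> = (cross_ind \<pi> (a, b, c, d) + cross_ind (mid_swap (a, b, c, d) \<pi>) (a, b, c, d)
      + cross_ind (mid_swap (a, b, d, c) \<pi>) (a, b, d, c)) * F \<pi>"
      unfolding cross_ind_three[OF q \<open>\<pi> \<in> perms\<close>] by simp
    then show "F \<pi> = cross_ind \<pi> (a, b, c, d) * F \<pi>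
      + (cross_ind (mid_swap (a, b, c, d) \<pi>) (a, b, c, d) * F \<pi>
      + cross_ind (mid_swap (a, b, d, c) \<pi>) (a, b, d, c) * F \<pi>)"
      by (simp only: distrib_right add.assoc)
  qed
  also have "\<dots> = ?A + (?B (a, b, c, d) + ?B (a, b, d, c))"
    unfolding mean_add mean_cross_ind_swap[OF q] mean_cross_ind_swap[OF quads_flip[OF q]] ..
  finally show ?thesis
    unfolding gap_def right_diff_distrib mean_diff cross_ind_flip by simp
qed

lemma mean_cross_ind:
  assumes "q \<in> quads"
  shows "mean perms (\<lambda>\<pi>. cross_ind \<pi> q) = 1 / 3"
proof -
  obtain a b c d where q: "q = (a, b, c, d)" by (cases q)
  show ?thesis
    using mean_cross_ind_three[of a b c d "\<lambda>_. 1"] assms perms_finite_nonempty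
    unfolding q by (simp add: mean_const)
qed

lemma mean_crossings: "mean perms (crossings E) = real (card quads) / 24"
proof -
  have "mean perms (crossings E) = mean perms (\<lambda>\<pi>. (1 / 8) * (\<Sum>q\<in>quads. cross_ind \<pi> q))"
    by (rule mean_cong) (simp add: perms_def crossings_eq_sum)
  also have "\<dots> = (1 / 8) * (\<Sum>q\<in>quads. mean perms (\<lambda>\<pi>. cross_ind \<pi> q))"
    by (simp only: mean_cmult mean_sum)
  finally show ?thesis by (simp add: mean_cross_ind)
qed

text \<open>The factor 1/12 is 1/8, for the eight quadruples of a 2-matching, times 2/3: there are
  three pairings, and the two gap terms have equal sums because flipping permutes
  \<open>quads\<close>. Centring cancels the term with \<open>mean perms F\<close>.\<close>

lemma covariance_crossings:
  "mean perms (\<lambda>\<pi>. (crossings E \<pi> - mean perms (crossings E)) * F \<pi>)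
    = (\<Sum>q\<in>quads. mean perms (\<lambda>\<pi>. cross_ind \<pi> q / 12 * (F \<pi> - F (mid_swap q \<pi>))))"
proof -
  define A where "A q = mean perms (\<lambda>\<pi>. cross_ind \<pi> q * F \<pi>)" for q
  define gap where "gap q = mean perms (\<lambda>\<pi>. cross_ind \<pi> q * (F \<pi> - F (mid_swap q \<pi>)))" for q
  let ?flip = "\<lambda>(a, b, c, d). (a, b, d, c) :: quad"
  have "3 * A q = mean perms F + gap q + gap (?flip q)" if "q \<in> quads" for q
    using that mean_cross_ind_three[of _ _ _ _ F] by (cases q) (simp add: A_def gap_def)
  then have "3 * (\<Sum>q\<in>quads. A q) = (\<Sum>q\<in>quads. mean perms F + gap q + gap (?flip q))"
    by (simp add: sum_distrib_left)
  also have "\<dots> = real (card quads) * mean perms F + (\<Sum>q\<in>quads. gap q) + (\<Sum>q\<in>quads. gap (?flip q))"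
    by (simp add: sum.distrib)
  also have "(\<Sum>q\<in>quads. gap (?flip q)) = (\<Sum>q\<in>quads. gap q)"
    by (rule sum.reindex_bij_witness[of _ ?flip ?flip]) (auto intro: quads_flip)
  finally have sum_A: "3 * (\<Sum>q\<in>quads. A q) = real (card quads) * mean perms F + 2 * (\<Sum>q\<in>quads. gap q)"
    by simp
  have "mean perms (\<lambda>\<pi>. crossings E \<pi> * F \<pi>)
      = mean perms (\<lambda>\<pi>. (1 / 8) * (\<Sum>q\<in>quads. cross_ind \<pi> q * F \<pi>))"
    by (rule mean_cong) (simp add: perms_def crossings_eq_sum sum_distrib_right)
  also have "\<dots> = (\<Sum>q\<in>quads. A q) / 8"
    unfolding mean_cmult mean_sum A_def by simp
  finally have "mean perms (\<lambda>\<pi>. (crossings E \<pi> - mean perms (crossings E)) * F \<pi>)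
      = (\<Sum>q\<in>quads. A q) / 8 - real (card quads) / 24 * mean perms F"
    by (simp only: left_diff_distrib mean_diff mean_cmult mean_crossings)
  also have "\<dots> = (1 / 12) * (\<Sum>q\<in>quads. gap q)"
    using sum_A by (simp add: field_simps)
  also have "\<dots> = (\<Sum>q\<in>quads. mean perms (\<lambda>\<pi>. (1 / 12) * (cross_ind \<pi> q * (F \<pi> - F (mid_swap q \<pi>)))))"
    unfolding mean_cmult gap_def sum_distrib_left ..
  finally show ?thesis by simp
qed

lemma crossings_diff:
  assumes "\<pi> \<in> perms" "\<rho> \<in> perms"
  shows "crossings E \<pi> - crossings E \<rho> = (\<Sum>q\<in>quads. cross_ind \<pi> q - cross_ind \<rho> q) / 8"
  using assms by (simp add: perms_def crossings_eq_sum sum_subtractf diff_divide_distrib)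

section \<open>Sensitivity of the swap gaps to moving one vertex\<close>

definition swap_gap :: "quad \<Rightarrow> (nat \<Rightarrow> nat) \<Rightarrow> real" where
  "swap_gap q \<pi> = crossings E \<pi> - crossings E (mid_swap q \<pi>)"

text \<open>Only chord pairs through \<open>b\<close> or \<open>c\<close> feel the swap, each
  indicator changing by at most 1. Each of the two vertices lies in at most
  \<open>8 * m * \<Delta>\<close> quadruples, and the sum is divided by 8.\<close>

lemma abs_swap_gap_le:
  assumes q: "q \<in> quads" and \<pi>: "\<pi> \<in> perms"
  shows "\<bar>swap_gap q \<pi>\<bar> \<le> 2 * real \<Delta> * real m"
proof -
  obtain a b c d where abcd: "q = (a, b, c, d)" by (cases q)
  have bc: "b \<in> {1..n}" "c \<in> {1..n}" using quadsD(2)[of a b c d] q abcd by auto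
  have card_le: "real (card {q' \<in> quads. v \<in> verts q'}) \<le> 8 * real m * real \<Delta>" if "v \<in> {1..n}" for v
  proof -
    have "card {q' \<in> quads. v \<in> verts q'} \<le> 8 * m * degree E v"
      by (rule card_quads_containing)
    also have "\<dots> \<le> 8 * m * \<Delta>" using degree_le[OF that] by simp
    finally have "real (card {q' \<in> quads. v \<in> verts q'}) \<le> real (8 * m * \<Delta>)"
      by (simp only: of_nat_le_iff)
    then show ?thesis by simp
  qed
  have summand: "\<bar>cross_ind \<pi> q' - cross_ind (mid_swap q \<pi>) q'\<bar>
      \<le> 1 * of_bool (b \<in> verts q') + 1 * of_bool (c \<in> verts q')" for q'
  proof (cases "b \<in> verts q' \<or> c \<in> verts q'")
    case True
    have "\<bar>cross_ind \<pi> q' - cross_ind (mid_swap q \<pi>) q'\<bar> \<le> 1"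
      using cross_ind_bounds[of \<pi> q'] cross_ind_bounds[of "mid_swap q \<pi>" q'] by linarith
    with True show ?thesis by auto
  qed (simp add: abcd cross_ind_mid_swap_disjoint del: mid_swap.simps)
  have "\<bar>swap_gap q \<pi>\<bar> = \<bar>\<Sum>q'\<in>quads. cross_ind \<pi> q' - cross_ind (mid_swap q \<pi>) q'\<bar> / 8"
    unfolding swap_gap_def crossings_diff[OF \<pi> mid_swap_perms[OF q \<pi>]] by simp
  also have "\<dots> \<le> (\<Sum>q'\<in>quads. \<bar>cross_ind \<pi> q' - cross_ind (mid_swap q \<pi>) q'\<bar>) / 8"
    by (intro divide_right_mono sum_abs) simp
  also have "\<dots> \<le> (\<Sum>q'\<in>quads. 1 * of_bool (b \<in> verts q') + 1 * of_bool (c \<in> verts q')) / 8"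
    by (intro divide_right_mono sum_mono summand) simp
  also have "\<dots> = (real (card {q' \<in> quads. b \<in> verts q'}) + real (card {q' \<in> quads. c \<in> verts q'})) / 8"
    unfolding sum.distrib sum_of_bool_card[OF finite_quads] by simp
  also have "\<dots> \<le> 2 * real \<Delta> * real m"
    using card_le[OF bc(1)] card_le[OF bc(2)] by (simp add: mult_ac)
  finally show ?thesis .
qed

text \<open>Moving a vertex \<open>w\<close> outside the swapped pair \<open>{b, c}\<close> only affects those chord pairs
  whose end points include both \<open>w\<close> and one of \<open>b\<close>, \<open>c\<close>.\<close>

lemma abs_swap_gap_diff_le:
  assumes q: "(a, b, c, d) \<in> quads" and \<pi>: "\<pi> \<in> perms" and \<rho>: "\<rho> \<in> perms"
    and w: "w \<noteq> b" "w \<noteq> c" and order: "same_order \<pi> \<rho> ({1..n} - {w})"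
  shows "\<bar>swap_gap (a, b, c, d) \<pi> - swap_gap (a, b, c, d) \<rho>\<bar>
    \<le> 4 * real (degree E w) * real \<Delta> + 2 * real m * of_bool (b \<in> nbrs w)
      + 2 * real m * of_bool (c \<in> nbrs w)"
proof -
  let ?s = "mid_swap (a, b, c, d)"
  have bc: "b \<in> {1..n}" "c \<in> {1..n}" using quadsD(2)[OF q] by auto
  \<comment> \<open>The second difference of the indicator under the swap and the move of
    \<open>w\<close>; it vanishes unless both operations touch \<open>q'\<close>.\<close>
  define t where "t q' = (cross_ind \<pi> q' - cross_ind (?s \<pi>) q') - (cross_ind \<rho> q' - cross_ind (?s \<rho>) q')" for q'
  let ?b = "\<lambda>q'. w \<in> verts q' \<and> b \<in> verts q'" and ?c = "\<lambda>q'. w \<in> verts q' \<and> c \<in> verts q'"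
  have summand: "\<bar>t q'\<bar> \<le> 2 * of_bool (?b q') + 2 * of_bool (?c q')" if q': "q' \<in> quads" for q'
  proof -
    have t2: "\<bar>t q'\<bar> \<le> 2"
      using cross_ind_bounds[of \<pi> q'] cross_ind_bounds[of "?s \<pi>" q']
        cross_ind_bounds[of \<rho> q'] cross_ind_bounds[of "?s \<rho>" q'] unfolding t_def by linarith
    consider "w \<notin> verts q'" | "b \<notin> verts q'" "c \<notin> verts q'" | "?b q' \<or> ?c q'" by blast
    then show ?thesis
    proof cases
      case 1
      have "verts q' \<subseteq> {1..n} - {w}"
        using 1 q' quadsD(2) by (cases q') (auto simp: subset_iff)
      moreover have "same_order (?s \<pi>) (?s \<rho>) ({1..n} - {w})"
        using w bc by (intro same_order_mid_swap order) auto
      ultimately have "t q' = 0"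
        using order unfolding t_def by (simp add: cross_ind_cong[OF same_order_subset] del: mid_swap.simps)
      then show ?thesis by simp
    next
      case 2
      then have "t q' = 0" by (simp add: t_def cross_ind_mid_swap_disjoint del: mid_swap.simps)
      then show ?thesis by simp
    next
      case 3
      with t2 show ?thesis by auto
    qed
  qed
  have count: "real (card {q' \<in> quads. w \<in> verts q' \<and> v \<in> verts q'})
      \<le> 8 * real (degree E w) * real \<Delta> + 8 * real m * of_bool (v \<in> nbrs w)"
    if "w \<noteq> v" "v \<in> {1..n}" for v
  proof -
    have "card {q' \<in> quads. w \<in> verts q' \<and> v \<in> verts q'}
        \<le> 8 * degree E w * degree E v + 8 * m * of_bool (v \<in> nbrs w)"
      by (rule card_quads_containing_two[OF that(1)])
    also have "\<dots> \<le> 8 * degree E w * \<Delta> + 8 * m * of_bool (v \<in> nbrs w)"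
      using degree_le[OF that(2)] by simp
    finally have "real (card {q' \<in> quads. w \<in> verts q' \<and> v \<in> verts q'})
        \<le> real (8 * degree E w * \<Delta> + 8 * m * of_bool (v \<in> nbrs w))"
      by (simp only: of_nat_le_iff)
    then show ?thesis by simp
  qed
  have "swap_gap (a, b, c, d) \<pi> - swap_gap (a, b, c, d) \<rho> = (\<Sum>q'\<in>quads. t q') / 8"
    unfolding swap_gap_def t_def crossings_diff[OF \<pi> mid_swap_perms[OF q \<pi>]]
      crossings_diff[OF \<rho> mid_swap_perms[OF q \<rho>]]
    by (simp add: sum_subtractf diff_divide_distrib del: mid_swap.simps)
  then have "\<bar>swap_gap (a, b, c, d) \<pi> - swap_gap (a, b, c, d) \<rho>\<bar> = \<bar>\<Sum>q'\<in>quads. t q'\<bar> / 8"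
    by (simp only: abs_divide abs_numeral)
  also have "\<dots> \<le> (\<Sum>q'\<in>quads. \<bar>t q'\<bar>) / 8"
    by (intro divide_right_mono sum_abs) simp
  also have "\<dots> \<le> (\<Sum>q'\<in>quads. 2 * of_bool (?b q') + 2 * of_bool (?c q')) / 8"
    by (intro divide_right_mono sum_mono summand) simp_all
  also have "\<dots> = (2 * real (card {q' \<in> quads. ?b q'}) + 2 * real (card {q' \<in> quads. ?c q'})) / 8"
    unfolding sum.distrib sum_of_bool_card[OF finite_quads] by simp
  also have "\<dots> \<le> 4 * real (degree E w) * real \<Delta> + 2 * real m * of_bool (b \<in> nbrs w)
      + 2 * real m * of_bool (c \<in> nbrs w)"
    using count[OF w(1) bc(1)] count[OF w(2) bc(2)] by (simp add: mult_ac)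
  finally show ?thesis .
qed

text \<open>For quadruples containing \<open>w\<close> both gaps are bounded separately; for the
  others the weight is unchanged and only the gap moves. The counts add up to
  \<open>32 + 16 + 4 + 4 = 56\<close>.\<close>

lemma weighted_swap_gap_diff_le:
  fixes \<psi> :: "(nat \<Rightarrow> nat) \<Rightarrow> quad \<Rightarrow> real"
  assumes bnd: "\<And>\<pi> q. \<pi> \<in> perms \<Longrightarrow> q \<in> quads \<Longrightarrow> 0 \<le> \<psi> \<pi> q \<and> \<psi> \<pi> q \<le> k"
    and local: "\<And>\<pi> \<rho> q. q \<in> quads \<Longrightarrow> same_order \<pi> \<rho> (verts q) \<Longrightarrow> \<psi> \<pi> q = \<psi> \<rho> q"
    and "0 \<le> k" and \<pi>: "\<pi> \<in> perms" and \<rho>: "\<rho> \<in> perms"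
    and order: "same_order \<pi> \<rho> ({1..n} - {w})"
  shows "\<bar>(\<Sum>q\<in>quads. \<psi> \<pi> q * swap_gap q \<pi>) - (\<Sum>q\<in>quads. \<psi> \<rho> q * swap_gap q \<rho>)\<bar>
    \<le> k * (56 * real \<Delta> * (real m)\<^sup>2 * real (degree E w))"
proof -
  let ?dw = "real (degree E w)" and ?\<Delta> = "real \<Delta>" and ?m = "real m"
  define B C where "B q = (case q of (a, b, c, d) \<Rightarrow> b \<in> nbrs w)"
    and "C q = (case q of (a, b, c, d) \<Rightarrow> c \<in> nbrs w)" for q :: quad
  define U where "U q = 4 * ?\<Delta> * ?m * of_bool (w \<in> verts q) + 4 * ?dw * ?\<Delta>
      + 2 * ?m * of_bool (B q) + 2 * ?m * of_bool (C q)" for q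
  have summand: "\<bar>\<psi> \<pi> q * swap_gap q \<pi> - \<psi> \<rho> q * swap_gap q \<rho>\<bar> \<le> k * U q" if q: "q \<in> quads" for q
  proof (cases "w \<in> verts q")
    case True
    have "\<bar>\<psi> \<rho>' q * swap_gap q \<rho>'\<bar> \<le> k * (2 * ?\<Delta> * ?m)" if "\<rho>' \<in> perms" for \<rho>'
      using bnd[OF that q] abs_swap_gap_le[OF q that] \<open>0 \<le> k\<close>
      unfolding abs_mult by (intro mult_mono) auto
    from this[OF \<pi>] this[OF \<rho>]
    have "\<bar>\<psi> \<pi> q * swap_gap q \<pi> - \<psi> \<rho> q * swap_gap q \<rho>\<bar> \<le> k * (4 * ?\<Delta> * ?m)"
      by (simp add: algebra_simps)
    also have "\<dots> \<le> k * U q"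
      using True by (intro mult_left_mono \<open>0 \<le> k\<close>) (simp add: U_def)
    finally show ?thesis .
  next
    case False
    obtain a b c d where abcd: "q = (a, b, c, d)" by (cases q)
    have "verts q \<subseteq> {1..n} - {w}"
      using False q quadsD(2)[of a b c d] by (auto simp: abcd)
    then have eq: "\<psi> \<pi> q = \<psi> \<rho> q"
      using local[OF q] same_order_subset[OF order] by blast
    have "\<bar>swap_gap q \<pi> - swap_gap q \<rho>\<bar> \<le> U q"
      using abs_swap_gap_diff_le[of a b c d \<pi> \<rho> w] q \<pi> \<rho> order False
      by (simp add: abcd U_def B_def C_def)
    then have "\<bar>\<psi> \<rho> q * (swap_gap q \<pi> - swap_gap q \<rho>)\<bar> \<le> k * U q"
      using bnd[OF \<rho> q] \<open>0 \<le> k\<close> unfolding abs_mult by (intro mult_mono) auto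
    then show ?thesis by (simp add: eq right_diff_distrib)
  qed
  have counts: "real (card {q \<in> quads. w \<in> verts q}) \<le> 8 * ?m * ?dw"
    "real (card {q \<in> quads. B q}) \<le> 2 * ?m * ?\<Delta> * ?dw"
    "real (card {q \<in> quads. C q}) \<le> 2 * ?m * ?\<Delta> * ?dw"
    "real (card quads) \<le> 4 * ?m\<^sup>2"
  proof -
    have sets: "{q \<in> quads. B q} = {(a, b, c, d) \<in> quads. b \<in> nbrs w}"
      "{q \<in> quads. C q} = {(a, b, c, d) \<in> quads. c \<in> nbrs w}"
      by (auto simp: B_def C_def)
    show "real (card {q \<in> quads. w \<in> verts q}) \<le> 8 * ?m * ?dw"
      "real (card {q \<in> quads. B q}) \<le> 2 * ?m * ?\<Delta> * ?dw"
      "real (card {q \<in> quads. C q}) \<le> 2 * ?m * ?\<Delta> * ?dw"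
      "real (card quads) \<le> 4 * ?m\<^sup>2"
      using card_quads_containing[of w, THEN of_nat_mono[where 'a = real]]
        card_quads_mid_adjacent(1)[of w, THEN of_nat_mono[where 'a = real]]
        card_quads_mid_adjacent(2)[of w, THEN of_nat_mono[where 'a = real]]
        card_quads_le[THEN of_nat_mono[where 'a = real]] unfolding sets by simp_all
  qed
  have "\<bar>(\<Sum>q\<in>quads. \<psi> \<pi> q * swap_gap q \<pi>) - (\<Sum>q\<in>quads. \<psi> \<rho> q * swap_gap q \<rho>)\<bar>
      \<le> (\<Sum>q\<in>quads. \<bar>\<psi> \<pi> q * swap_gap q \<pi> - \<psi> \<rho> q * swap_gap q \<rho>\<bar>)"
    unfolding sum_subtractf[symmetric] by (rule sum_abs)
  also have "\<dots> \<le> (\<Sum>q\<in>quads. k * U q)"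
    by (intro sum_mono summand)
  also have "\<dots> = k * (\<Sum>q\<in>quads. U q)"
    by (simp only: sum_distrib_left)
  also have "(\<Sum>q\<in>quads. U q) = 4 * ?\<Delta> * ?m * real (card {q \<in> quads. w \<in> verts q})
      + 4 * ?dw * ?\<Delta> * real (card quads)
      + 2 * ?m * real (card {q \<in> quads. B q}) + 2 * ?m * real (card {q \<in> quads. C q})"
    unfolding U_def sum.distrib sum_of_bool_card[OF finite_quads] by simp
  also have "k * \<dots> \<le> k * (4 * ?\<Delta> * ?m * (8 * ?m * ?dw) + 4 * ?dw * ?\<Delta> * (4 * ?m\<^sup>2)
      + 2 * ?m * (2 * ?m * ?\<Delta> * ?dw) + 2 * ?m * (2 * ?m * ?\<Delta> * ?dw))"
    by (intro mult_left_mono add_mono counts \<open>0 \<le> k\<close>) simp_all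
  also have "\<dots> = k * (56 * ?\<Delta> * ?m\<^sup>2 * ?dw)"
    by (simp add: power2_eq_square algebra_simps)
  finally show ?thesis .
qed

text \<open>The constant is \<open>56\<^sup>2 / 4 * 2\<close>, where the last factor comes from the
  bound \<open>2 * m * \<Delta>\<close> on the sum of squared degrees.\<close>

lemma weighted_swap_gap_variance:
  fixes \<psi> :: "(nat \<Rightarrow> nat) \<Rightarrow> quad \<Rightarrow> real"
  defines "S \<equiv> \<lambda>\<pi>. \<Sum>q\<in>quads. \<psi> \<pi> q * swap_gap q \<pi>"
  assumes bnd: "\<And>\<pi> q. \<pi> \<in> perms \<Longrightarrow> q \<in> quads \<Longrightarrow> 0 \<le> \<psi> \<pi> q \<and> \<psi> \<pi> q \<le> k"
    and local: "\<And>\<pi> \<rho> q. q \<in> quads \<Longrightarrow> same_order \<pi> \<rho> (verts q) \<Longrightarrow> \<psi> \<pi> q = \<psi> \<rho> q"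
    and "0 \<le> k"
  shows "mean perms (\<lambda>\<pi>. (S \<pi> - mean perms S)\<^sup>2) \<le> 1568 * k\<^sup>2 * real \<Delta> ^ 3 * real m ^ 5"
proof -
  define K where "K = k * (56 * real \<Delta> * (real m)\<^sup>2)"
  have "mean perms (\<lambda>\<pi>. (S \<pi> - mean perms S)\<^sup>2) \<le> (\<Sum>v\<in>{1..n}. (K * real (degree E v))\<^sup>2) / 4"
  proof (rule bounded_differences_permutations[of n, folded perms_def])
    fix v \<pi> \<rho>
    assume "\<pi> \<in> perms" "\<rho> \<in> perms"
      and "\<And>i j. i \<in> {1..n} - {v} \<Longrightarrow> j \<in> {1..n} - {v} \<Longrightarrow> \<pi> i < \<pi> j \<longleftrightarrow> \<rho> i < \<rho> j"
    then show "\<bar>S \<pi> - S \<rho>\<bar> \<le> K * real (degree E v)"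
      using weighted_swap_gap_diff_le[of \<psi> k \<pi> \<rho> v] bnd local \<open>0 \<le> k\<close>
      unfolding S_def K_def same_order_def by (simp add: mult_ac)
  qed
  also have "\<dots> = K\<^sup>2 / 4 * (\<Sum>v\<in>{1..n}. (real (degree E v))\<^sup>2)"
    by (simp only: power_mult_distrib sum_distrib_left[symmetric] times_divide_eq_left)
  also have "\<dots> \<le> K\<^sup>2 / 4 * (2 * real m * real \<Delta>)"
    by (intro mult_left_mono sum_degree_square_le) simp
  also have "\<dots> = 1568 * k\<^sup>2 * real \<Delta> ^ 3 * real m ^ 5"
    by (simp add: K_def power2_eq_square power3_eq_cube eval_nat_numeral)
  finally show ?thesis .
qed

text \<open>Weights of at most 1/12 give the variance constant \<open>1568 / 144 = 98 / 9\<close>.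
  The factor 3/2 adds the full share of \<open>T\<close> and the half share of
  \<open>T'\<close>.\<close>

theorem crossings_normal_approximation:
  fixes \<sigma> z :: real
  assumes \<sigma>: "0 < \<sigma>" and var: "\<sigma>\<^sup>2 = mean perms (\<lambda>\<pi>. (crossings E \<pi> - mean perms (crossings E))\<^sup>2)"
  shows "\<bar>mean perms (\<lambda>\<pi>. if (crossings E \<pi> - mean perms (crossings E)) / \<sigma> \<le> z then 1 else 0) - normal_cdf z\<bar>
      \<le> 3 / 2 * sqrt (98 / 9 * real \<Delta> ^ 3 * real m ^ 5) / \<sigma>\<^sup>2"
    and "\<sigma>\<^sup>2 \<le> 4 / 9 * real (num_matchings 2 E) * real \<Delta> * real m"
proof -
  define \<eta> where "\<eta> q \<pi> = cross_ind \<pi> q / 12" for q \<pi>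
  define T where "T \<pi> = (\<Sum>q\<in>quads. \<eta> q \<pi> * swap_gap q \<pi>)" for \<pi>
  define T' where "T' \<pi> = (\<Sum>q\<in>quads. (\<eta> q \<pi> + \<eta> q (mid_swap q \<pi>)) * swap_gap q \<pi>)" for \<pi>
  have \<eta>_cong: "\<eta> q \<pi> = \<eta> q \<rho>" if "same_order \<pi> \<rho> (verts q)" for q \<pi> \<rho>
    using cross_ind_cong[OF that] by (simp add: \<eta>_def)
  have \<eta>_swap_cong: "\<eta> q (mid_swap q \<pi>) = \<eta> q (mid_swap q \<rho>)"
    if q: "q \<in> quads" and "same_order \<pi> \<rho> (verts q)" for q \<pi> \<rho>
  proof -
    obtain a b c d where abcd: "q = (a, b, c, d)" by (cases q)
    have "cross_ind (mid_swap q \<pi>) q = cross_ind \<pi> (a, c, b, d)" for \<pi>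
      using quadsD(1)[of a b c d] q unfolding abcd by (intro cross_ind_mid_swap) auto
    moreover have "cross_ind \<pi> (a, c, b, d) = cross_ind \<rho> (a, c, b, d)"
      using that(2) by (intro cross_ind_cong) (simp add: abcd insert_commute)
    ultimately show ?thesis by (simp add: \<eta>_def)
  qed
  \<comment> \<open>At most one of the two pairings exchanged by the swap crosses, so even the sum
    of the two weights is at most 1/12.\<close>
  have bnd: "0 \<le> \<eta> q \<pi> \<and> \<eta> q \<pi> \<le> 1 / 12"
    "0 \<le> \<eta> q \<pi> + \<eta> q (mid_swap q \<pi>) \<and> \<eta> q \<pi> + \<eta> q (mid_swap q \<pi>) \<le> 1 / 12"
    if "q \<in> quads" "\<pi> \<in> perms" for q \<pi>
  proof -
    obtain a b c d where abcd: "q = (a, b, c, d)" by (cases q)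
    show "0 \<le> \<eta> q \<pi> \<and> \<eta> q \<pi> \<le> 1 / 12"
      "0 \<le> \<eta> q \<pi> + \<eta> q (mid_swap q \<pi>) \<and> \<eta> q \<pi> + \<eta> q (mid_swap q \<pi>) \<le> 1 / 12"
      using cross_ind_three[of a b c d \<pi>] that cross_ind_bounds[of "mid_swap (a, b, d, c) \<pi>" "(a, b, d, c)"]
        cross_ind_bounds[of \<pi> q] cross_ind_bounds[of "mid_swap q \<pi>" q]
      by (auto simp: \<eta>_def abcd simp del: mid_swap.simps)
  qed
  have varT: "mean perms (\<lambda>\<pi>. (T \<pi> - mean perms T)\<^sup>2) \<le> 98 / 9 * real \<Delta> ^ 3 * real m ^ 5"
    using weighted_swap_gap_variance[of "\<lambda>\<pi> q. \<eta> q \<pi>" "1 / 12", folded T_def] bnd(1) \<eta>_cong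
    by (simp add: power2_eq_square)
  have varT': "mean perms (\<lambda>\<pi>. (T' \<pi> - mean perms T')\<^sup>2) \<le> 98 / 9 * real \<Delta> ^ 3 * real m ^ 5"
  proof -
    have "mean perms (\<lambda>\<pi>. (T' \<pi> - mean perms T')\<^sup>2) \<le> 1568 * (1 / 12)\<^sup>2 * real \<Delta> ^ 3 * real m ^ 5"
      unfolding T'_def
    proof (rule weighted_swap_gap_variance[of "\<lambda>\<pi> q. \<eta> q \<pi> + \<eta> q (mid_swap q \<pi>)"])
      fix \<pi> q assume "\<pi> \<in> perms" "q \<in> quads"
      then show "0 \<le> \<eta> q \<pi> + \<eta> q (mid_swap q \<pi>) \<and> \<eta> q \<pi> + \<eta> q (mid_swap q \<pi>) \<le> 1 / 12"
        by (rule bnd(2)[rotated])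
    next
      fix \<pi> \<rho> q assume "q \<in> quads" "same_order \<pi> \<rho> (verts q)"
      then show "\<eta> q \<pi> + \<eta> q (mid_swap q \<pi>) = \<eta> q \<rho> + \<eta> q (mid_swap q \<rho>)"
        by (intro arg_cong2[where f = "(+)"] \<eta>_cong \<eta>_swap_cong)
    qed simp
    then show ?thesis by (simp add: power2_eq_square)
  qed
  note stein = stein_exchange_bound[where P = perms and Q = quads and X = "crossings E" and \<eta> = \<eta>
      and \<tau> = mid_swap and \<mu> = "mean perms (crossings E)" and \<sigma> = \<sigma>,
      OF perms_finite_nonempty mean_mid_swap mid_swap_mid_swap _ \<sigma> var _ refl,
      folded swap_gap_def, folded T_def T'_def]
  have cov: "mean perms (\<lambda>\<pi>. (crossings E \<pi> - mean perms (crossings E)) * F \<pi>)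
      = (\<Sum>q\<in>quads. mean perms (\<lambda>\<pi>. \<eta> q \<pi> * (F \<pi> - F (mid_swap q \<pi>))))" for F
    unfolding \<eta>_def by (rule covariance_crossings)
  have "\<bar>mean perms (\<lambda>\<pi>. if (crossings E \<pi> - mean perms (crossings E)) / \<sigma> \<le> z then 1 else 0) - normal_cdf z\<bar>
      \<le> (sqrt (mean perms (\<lambda>\<pi>. (T \<pi> - mean perms T)\<^sup>2))
        + sqrt (mean perms (\<lambda>\<pi>. (T' \<pi> - mean perms T')\<^sup>2)) / 2) / \<sigma>\<^sup>2"
    by (rule stein(1)) (use bnd(1) cov in auto)
  also have "\<dots> \<le> (sqrt (98 / 9 * real \<Delta> ^ 3 * real m ^ 5) + sqrt (98 / 9 * real \<Delta> ^ 3 * real m ^ 5) / 2) / \<sigma>\<^sup>2"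
    by (intro divide_right_mono add_mono real_sqrt_le_mono varT varT') simp_all
  finally show "\<bar>mean perms (\<lambda>\<pi>. if (crossings E \<pi> - mean perms (crossings E)) / \<sigma> \<le> z then 1 else 0) - normal_cdf z\<bar>
      \<le> 3 / 2 * sqrt (98 / 9 * real \<Delta> ^ 3 * real m ^ 5) / \<sigma>\<^sup>2"
    by simp
  have "\<sigma>\<^sup>2 = mean perms T"
    by (rule stein(2)[symmetric]) (use bnd(1) cov in auto)
  \<comment> \<open>Each gap is at most \<open>2 * \<Delta> * m\<close> and each weight has mean
    1/36; with 8 quadruples per 2-matching this yields the constant 4/9.\<close>
  also have "\<dots> \<le> mean perms (\<lambda>\<pi>. \<Sum>q\<in>quads. (2 * real \<Delta> * real m / 12) * cross_ind \<pi> q)"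
    unfolding T_def
  proof (intro mean_mono sum_mono)
    fix \<pi> q assume "\<pi> \<in> perms" "q \<in> quads"
    then have "\<eta> q \<pi> * swap_gap q \<pi> \<le> \<eta> q \<pi> * (2 * real \<Delta> * real m)"
      using abs_swap_gap_le[of q \<pi>] bnd(1)[of q \<pi>] by (intro mult_left_mono) auto
    then show "\<eta> q \<pi> * swap_gap q \<pi> \<le> (2 * real \<Delta> * real m / 12) * cross_ind \<pi> q"
      by (simp add: \<eta>_def mult_ac)
  qed
  also have "\<dots> = (2 * real \<Delta> * real m / 12) * (real (card quads) / 3)"
    unfolding mean_sum mean_cmult sum_distrib_left[symmetric] by (simp add: mean_cross_ind)
  finally show "\<sigma>\<^sup>2 \<le> 4 / 9 * real (num_matchings 2 E) * real \<Delta> * real m"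
    by (simp add: card_quads mult_ac)
qed

end

section \<open>Elementary inequalities and the conclusion\<close>

lemma matchings_4_le:
  assumes "finite E"
  shows "6 * num_matchings 4 E \<le> (num_matchings 2 E)\<^sup>2"
proof -
  have fin: "finite (matchings r E)" for r
    by (rule finite_subset[of _ "Pow E"]) (auto simp: matchings_def assms)
  \<comment> \<open>Each 4-matching \<open>N\<close> has 6 subsets \<open>M\<close> of size 2, and
    the pair of \<open>M\<close> and \<open>N - M\<close> determines both.\<close>
  let ?S = "SIGMA N:matchings 4 E. {M. M \<subseteq> N \<and> card M = 2}"
  have fin_N: "finite N" if "N \<in> matchings r E" for N r
    using that assms by (auto simp: matchings_def intro: finite_subset)
  have "card ?S = (\<Sum>N\<in>matchings 4 E. card {M. M \<subseteq> N \<and> card M = 2})"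
    by (rule card_SigmaI) (auto simp: fin intro: finite_subset[OF _ finite_Pow_iff[THEN iffD2, OF fin_N]])
  also have "\<dots> = (\<Sum>N\<in>matchings 4 E. 6)"
  proof (rule sum.cong[OF refl])
    fix N assume "N \<in> matchings 4 E"
    then show "card {M. M \<subseteq> N \<and> card M = 2} = 6"
      using n_subsets[OF fin_N, of N 4 2] by (simp add: matchings_def binomial_fact eval_nat_numeral)
  qed
  finally have "6 * num_matchings 4 E = card ?S" by (simp add: num_matchings_def)
  also have "\<dots> \<le> card (matchings 2 E \<times> matchings 2 E)"
  proof (rule card_inj_on_le[of "\<lambda>(N, M). (M, N - M)"])
    show "inj_on (\<lambda>(N, M). (M, N - M)) ?S" by (auto simp: inj_on_def)
    show "(\<lambda>(N, M). (M, N - M)) ` ?S \<subseteq> matchings 2 E \<times> matchings 2 E"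
    proof clarify
      fix N M assume N: "N \<in> matchings 4 E" and M: "M \<subseteq> N" "card M = 2"
      have sub: "K \<in> matchings 2 E" if "K \<subseteq> N" "card K = 2" for K
        using N that by (auto simp: matchings_def intro: pairwise_subset)
      have "card (N - M) = 2"
        using N M finite_subset[OF M(1) fin_N[OF N]] by (simp add: card_Diff_subset matchings_def)
      then show "M \<in> matchings 2 E \<and> N - M \<in> matchings 2 E"
        using M by (intro conjI sub) auto
    qed
  qed (simp add: fin)
  finally show ?thesis by (simp add: card_cartesian_product num_matchings_def power2_eq_square)
qed

text \<open>For \<open>s \<le> 18 * D * k\<close> the bound exceeds 1. Otherwise the variance bound forces \<open>k\<close> to be large
  compared with \<open>D\<close>, so that \<open>M\<close> is of order \<open>k\<^sup>2\<close>.\<close>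

lemma bound_arithmetic:
  fixes s M D k d :: real
  assumes s: "0 < s" and nonneg: "0 \<le> M" "0 \<le> D" "0 \<le> k"
    and var: "s\<^sup>2 \<le> 4 / 9 * M * D * k" and up: "2 * M \<le> k\<^sup>2" and low: "k\<^sup>2 - 2 * k * D \<le> 2 * M"
    and d1: "d \<le> 1" and d: "d \<le> 3 / 2 * sqrt (98 / 9 * D ^ 3 * k ^ 5) / s\<^sup>2"
  shows "d \<le> 8 * M * D\<^sup>2 * k\<^sup>2 / s ^ 3"
proof -
  have "0 < s\<^sup>2" using s by simp
  moreover have "s\<^sup>2 \<le> 4 / 9 * (M * D * k)" using var by (simp add: mult.assoc)
  ultimately have "0 < M * D * k" by linarith
  then have pos: "0 < M" "0 < D" "0 < k" using nonneg by (auto simp: zero_less_mult_iff)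
  show ?thesis
  proof (cases "s \<le> 18 * D * k")
    case True
    have "s ^ 3 = s\<^sup>2 * s" by (simp add: power2_eq_square power3_eq_cube)
    \<comment> \<open>The threshold 18 is chosen so that \<open>4 / 9 * 18 = 8\<close>.\<close>
    also have "\<dots> \<le> (4 / 9 * M * D * k) * (18 * D * k)"
      using var True s pos by (intro mult_mono) auto
    also have "\<dots> = 8 * M * D\<^sup>2 * k\<^sup>2" by (simp add: power2_eq_square)
    finally have "1 \<le> 8 * M * D\<^sup>2 * k\<^sup>2 / s ^ 3" using s by (simp add: pos_le_divide_eq)
    with d1 show ?thesis by linarith
  next
    case False
    have "(18 * D * k)\<^sup>2 \<le> s\<^sup>2" using False pos by (intro power_mono) auto
    also have "\<dots> \<le> (4 / 9 * D * k) * M" using var by (simp add: mult_ac)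
    also have "\<dots> \<le> (4 / 9 * D * k) * (k\<^sup>2 / 2)"
      using up pos by (intro mult_left_mono) auto
    finally have "(D * k\<^sup>2) * (324 * D) \<le> (D * k\<^sup>2) * (2 / 9 * k)"
      by (simp add: power2_eq_square mult_ac)
    then have "324 * D \<le> 2 / 9 * k"
      using pos by (subst (asm) mult_le_cancel_left_pos) auto
    then have "k * (2 * D) \<le> k * (k / 2)" using pos by (intro mult_left_mono) auto
    then have M: "k\<^sup>2 / 4 \<le> M" using low by (simp add: power2_eq_square mult_ac)
    \<comment> \<open>After squaring, \<open>s\<^sup>2\<close> is bounded by the variance estimate
      and one factor \<open>k\<^sup>2\<close> by \<open>4 * M\<close>; what remains is
      \<open>392 / 9 \<le> 64\<close>.\<close>
    have "3 / 2 * sqrt (98 / 9 * D ^ 3 * k ^ 5) * s \<le> 8 * M * D\<^sup>2 * k\<^sup>2"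
    proof (rule power2_le_imp_le)
      have "(3 / 2 * sqrt (98 / 9 * D ^ 3 * k ^ 5) * s)\<^sup>2 = (3 / 2)\<^sup>2 * (sqrt (98 / 9 * D ^ 3 * k ^ 5))\<^sup>2 * s\<^sup>2"
        by (simp only: power_mult_distrib)
      also have "\<dots> = 49 / 2 * D ^ 3 * k ^ 5 * s\<^sup>2"
        using pos by (subst real_sqrt_pow2) (auto simp: power2_eq_square[of "3 / 2 :: real"])
      also have "\<dots> \<le> 49 / 2 * D ^ 3 * k ^ 5 * (4 / 9 * M * D * k)"
        using pos by (intro mult_left_mono var) auto
      also have "\<dots> = (98 / 9 * M * D ^ 4 * k ^ 4) * k\<^sup>2"
        by (simp add: eval_nat_numeral)
      also have "\<dots> \<le> (98 / 9 * M * D ^ 4 * k ^ 4) * (4 * M)"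
        using M pos by (intro mult_left_mono) auto
      also have "\<dots> = (392 / 9) * (M\<^sup>2 * D ^ 4 * k ^ 4)" by (simp add: power2_eq_square)
      also have "\<dots> \<le> 64 * (M\<^sup>2 * D ^ 4 * k ^ 4)"
        using pos by (intro mult_right_mono) auto
      also have "\<dots> = (8 * M * D\<^sup>2 * k\<^sup>2)\<^sup>2" by (simp add: power_mult_distrib flip: power_mult)
      finally show "(3 / 2 * sqrt (98 / 9 * D ^ 3 * k ^ 5) * s)\<^sup>2 \<le> (8 * M * D\<^sup>2 * k\<^sup>2)\<^sup>2" .
    qed (use pos in auto)
    then have "3 / 2 * sqrt (98 / 9 * D ^ 3 * k ^ 5) \<le> 8 * M * D\<^sup>2 * k\<^sup>2 / s"
      using s by (simp add: pos_le_divide_eq)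
    then have "3 / 2 * sqrt (98 / 9 * D ^ 3 * k ^ 5) / s\<^sup>2 \<le> 8 * M * D\<^sup>2 * k\<^sup>2 / s / s\<^sup>2"
      by (rule divide_right_mono) simp
    with d show ?thesis by (simp add: power2_eq_square power3_eq_cube mult_ac)
  qed
qed

lemma cdf_random_embedding:
  "cdf (distr (measure_pmf (random_embedding n)) borel W) z
    = mean {\<pi>. \<pi> permutes {1..n}} (\<lambda>\<pi>. if W \<pi> \<le> z then 1 else 0)"
proof -
  let ?P = "{\<pi>. \<pi> permutes {1..n}}"
  have P: "finite ?P" "?P \<noteq> {}" by (auto simp: finite_permutations intro: permutes_id)
  have "cdf (distr (measure_pmf (random_embedding n)) borel W) z
      = measure (measure_pmf (random_embedding n)) {\<pi>. W \<pi> \<le> z}"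
    by (simp add: cdf_def measure_distr vimage_def)
  also have "\<dots> = real (card (?P \<inter> {\<pi>. W \<pi> \<le> z})) / real (card ?P)"
    unfolding random_embedding_def by (rule measure_pmf_of_set[OF P(2,1)])
  also have "\<dots> = mean ?P (\<lambda>\<pi>. if W \<pi> \<le> z then 1 else 0)"
    using P by (simp add: mean_def sum.If_cases)
  finally show ?thesis .
qed

lemma cdf_std_normal:
  assumes "distributed N lborel Z std_normal_density"
  shows "cdf (distr N borel Z) z = normal_cdf z"
proof -
  have "Z \<in> borel_measurable N" using distributed_measurable[OF assms] by simp
  then have "cdf (distr N borel Z) z = measure (distr N lborel Z) {..z}"
    by (simp add: cdf_def measure_distr)
  also have "distr N lborel Z = std_normal_distribution"
    using distributed_distr_eq_density[OF assms] by simp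
  finally show ?thesis by (simp add: cdf_def)
qed

theorem theorem3:
  fixes n m \<Delta> :: nat and E :: "nat set set" and \<mu> \<sigma> :: real
    and W :: "(nat \<Rightarrow> nat) \<Rightarrow> real" and N :: "'a measure" and Z :: "'a \<Rightarrow> real"
  assumes "simple_graph n E"
    and "m = card E"
    and "\<Delta> = max_degree n E"
    and "\<mu> = measure_pmf.expectation (random_embedding n) (crossings E)"
    and "\<sigma> = sqrt (measure_pmf.variance (random_embedding n) (crossings E))"
    and "measure_pmf.variance (random_embedding n) (crossings E) > 0"
    and "W = (\<lambda>\<pi>. (crossings E \<pi> - \<mu>) / \<sigma>)"
    and "prob_space N"
    and "distributed N lborel Z std_normal_density"
  shows "kolmogorov_dist (measure_pmf (random_embedding n)) W N Z \<le>
    4 * real (num_matchings 2 E) * real \<Delta> * real m / (3 * \<sigma>\<^sup>2) *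
      (6 * real \<Delta> * real m / \<sigma> +
       sqrt (1 - 6 * real (num_matchings 4 E) / (real (num_matchings 2 E))\<^sup>2
             + (real \<Delta> - 1)\<^sup>2 * real m / (2 * real (num_matchings 2 E))))"
proof -
  interpret bounded_degree_graph n E m \<Delta>
  proof
    fix v assume "v \<in> {1..n}"
    then show "degree E v \<le> \<Delta>"
      unfolding assms(3) max_degree_def by (intro Max_ge) auto
  qed (use assms in auto)
  have perms: "perms = {\<pi>. \<pi> permutes {1..n}}" by (rule perms_def)
  have expectation: "measure_pmf.expectation (random_embedding n) F = mean perms F"
    for F :: "(nat \<Rightarrow> nat) \<Rightarrow> real"
    unfolding random_embedding_def mean_def perms[symmetric] by (rule integral_pmf_of_set[OF perms_finite_nonempty(2,1)])
  have \<mu>: "\<mu> = mean perms (crossings E)" using assms(4) by (simp add: expectation)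
  have \<sigma>: "0 < \<sigma>" and var: "\<sigma>\<^sup>2 = mean perms (\<lambda>\<pi>. (crossings E \<pi> - mean perms (crossings E))\<^sup>2)"
    using assms(5,6) by (simp_all add: expectation)
  let ?M = "real (num_matchings 2 E)"
  let ?R = "1 - 6 * real (num_matchings 4 E) / ?M\<^sup>2 + (real \<Delta> - 1)\<^sup>2 * real m / (2 * ?M)"
  \<comment> \<open>The square root of a negative number would be negative, so dropping this summand
    requires a nonnegative radicand. For \<open>?M = 0\<close> both quotients are 0 by
    convention.\<close>
  have R: "0 \<le> ?R"
  proof -
    have "6 * real (num_matchings 4 E) \<le> ?M\<^sup>2"
      using matchings_4_le[OF finite_E, THEN of_nat_mono[where 'a = real]] by simp
    then have "6 * real (num_matchings 4 E) / ?M\<^sup>2 \<le> 1"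
      by (auto simp: divide_le_eq_1)
    moreover have "0 \<le> (real \<Delta> - 1)\<^sup>2 * real m / (2 * ?M)" by simp
    ultimately show ?thesis by linarith
  qed
  have pointwise: "\<bar>cdf (distr (measure_pmf (random_embedding n)) borel W) z - cdf (distr N borel Z) z\<bar>
      \<le> 8 * ?M * (real \<Delta>)\<^sup>2 * (real m)\<^sup>2 / \<sigma> ^ 3" for z
  proof -
    define F where "F = mean perms (\<lambda>\<pi>. if W \<pi> \<le> z then 1 else 0)"
    have cdf: "\<bar>cdf (distr (measure_pmf (random_embedding n)) borel W) z - cdf (distr N borel Z) z\<bar>
        = \<bar>F - normal_cdf z\<bar>"
      unfolding F_def cdf_random_embedding perms cdf_std_normal[OF assms(9)] ..
    have "0 \<le> F" unfolding F_def by (rule mean_nonneg) simp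
    moreover have "F \<le> mean perms (\<lambda>_. 1)" unfolding F_def by (rule mean_mono) simp
    ultimately have "\<bar>F - normal_cdf z\<bar> \<le> 1"
      using normal_cdf_le_1[of z] std_normal.cdf_nonneg[of z]
      unfolding mean_const[OF perms_finite_nonempty] by linarith
    moreover have "\<bar>F - normal_cdf z\<bar> \<le> 3 / 2 * sqrt (98 / 9 * real \<Delta> ^ 3 * real m ^ 5) / \<sigma>\<^sup>2"
      unfolding F_def assms(7) \<mu> by (rule crossings_normal_approximation(1)[OF \<sigma> var])
    \<comment> \<open>The bounds on the number of quadruples, divided by 4; there are
      \<open>8 * ?M\<close> of them.\<close>
    moreover have "2 * ?M \<le> (real m)\<^sup>2" "(real m)\<^sup>2 - 2 * real m * real \<Delta> \<le> 2 * ?M"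
      using card_quads_le[THEN of_nat_mono[where 'a = real]]
        card_quads_ge[THEN of_nat_mono[where 'a = real]] by (simp_all add: card_quads)
    ultimately show ?thesis
      unfolding cdf using crossings_normal_approximation(2)[OF \<sigma> var]
      by (intro bound_arithmetic \<sigma>) simp_all
  qed
  have "kolmogorov_dist (measure_pmf (random_embedding n)) W N Z
      \<le> 8 * ?M * (real \<Delta>)\<^sup>2 * (real m)\<^sup>2 / \<sigma> ^ 3"
    unfolding kolmogorov_dist_def by (rule cSUP_least) (simp_all add: pointwise)
  \<comment> \<open>As \<open>8 = 4 * 6 / 3\<close>, this is exactly the first summand of the
    claimed bound.\<close>
  also have "\<dots> = 4 * ?M * real \<Delta> * real m / (3 * \<sigma>\<^sup>2) * (6 * real \<Delta> * real m / \<sigma>)"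
    using \<sigma> by (simp add: field_simps power2_eq_square power3_eq_cube)
  also have "\<dots> \<le> 4 * ?M * real \<Delta> * real m / (3 * \<sigma>\<^sup>2) * (6 * real \<Delta> * real m / \<sigma> + sqrt ?R)"
    using R by (intro mult_left_mono) auto
  finally show ?thesis .
qed

end
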